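(* For every integer $d\geq 2$ we have $p_c(\mathbb{K}^d,\mathbb{Z}^d_{[M]})\to 0$ as $M\to\infty$.
   Context: Graphs are undirected. For graphs $G,H$ and $p\in[0,1]$, consider site percolation on $H$: each vertex of $H$ is open with probability $p$ and otherwise closed, independently for different vertices. An embedding of $G$ in the open set of $H$ is an injective map from the vertex set of $G$ to the set of open vertices of $H$ such that neighbours in $G$ map to neighbours in $H$. The critical probability is $$p_c(G,H):=\inf\bigl\{p\in[0,1]:\mathbb{P}(\text{there exists an embedding of } G \text{ in the open set of } H)>0\bigr\}.$$ For an integer $M\ge 1$, $\mathbb{Z}^d_{[M]}$ is the graph with vertex set $\mathbb{Z}^d$ in which $x,y$ are joined by an edge whenever $0<\|x-y\|_\infty\leq M$. The comb graph $\mathbb{K}^d$ has vertex set $\mathbb{Z}^d$ and edges $(z,z+e_i)$ for every $z\in\mathbb{Z}^d$ and all $1\leq i\leq d-1$, together with the edges $(z,z+e_d)$ for all $z\in\mathbb{Z}^d$ with $z_1=0$, where $e_1,\dots,e_d$ are the standard basis vectors. *)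

theory Defs
  imports "HOL-Probability.Probability"
begin

text \<open>Edges are unordered pairs of vertices, so every graph is undirected.\<close>

record 'a graph =
  verts :: "'a set"
  edges :: "'a set set"

definition embedding_into :: "'a graph \<Rightarrow> 'b graph \<Rightarrow> 'b set \<Rightarrow> ('a \<Rightarrow> 'b) \<Rightarrow> bool" where
  "embedding_into G H U f \<longleftrightarrow>
     inj_on f (verts G) \<and> f ` verts G \<subseteq> U \<and>
     (\<forall>x\<in>verts G. \<forall>y\<in>verts G. {x, y} \<in> edges G \<longrightarrow> {f x, f y} \<in> edges H)"

definition site_percolation :: "'b graph \<Rightarrow> real \<Rightarrow> ('b \<Rightarrow> bool) measure" where
  "site_percolation H p = Pi\<^sub>M (verts H) (\<lambda>_. measure_pmf (bernoulli_pmf p))"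

definition open_set :: "'b graph \<Rightarrow> ('b \<Rightarrow> bool) \<Rightarrow> 'b set" where
  "open_set H \<omega> = {v \<in> verts H. \<omega> v}"

text \<open>
  The library assigns measure 0 to non-measurable sets. For connected countable \<open>G\<close> and
  locally finite countable \<open>H\<close>, which covers the graphs defined below, the embedding event is
  measurable: by compactness, an embedding with a prescribed image of one vertex exists iff
  all finite balls of \<open>G\<close> around that vertex can be so embedded. The infimum is over a nonempty
  set as soon as \<open>G\<close> embeds in \<open>H\<close> and this event is measurable, since then \<open>p = 1\<close> belongs to it.
\<close>

definition critical_prob :: "'a graph \<Rightarrow> 'b graph \<Rightarrow> real" where
  "critical_prob G H =
     Inf {p \<in> {0..1}.
       measure (site_percolation H p)
         {\<omega> \<in> space (site_percolation H p). \<exists>f. embedding_into G H (open_set H \<omega>) f} > 0}"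

text \<open>
  Points of the \<open>d\<close>-dimensional integer lattice are functions on the coordinates \<open>1, \<dots>, d\<close>,
  with the value \<open>undefined\<close> elsewhere, so that equality is coordinatewise.
\<close>

definition lattice :: "nat \<Rightarrow> (nat \<Rightarrow> int) set" where
  "lattice d = {1..d} \<rightarrow>\<^sub>E UNIV"

definition sup_dist :: "nat \<Rightarrow> (nat \<Rightarrow> int) \<Rightarrow> (nat \<Rightarrow> int) \<Rightarrow> int" where
  "sup_dist d x y = (MAX i\<in>{1..d}. \<bar>x i - y i\<bar>)"

definition lattice_graph :: "nat \<Rightarrow> nat \<Rightarrow> (nat \<Rightarrow> int) graph" where
  "lattice_graph d M =
     \<lparr>verts = lattice d,
      edges = {{x, y} | x y. x \<in> lattice d \<and> y \<in> lattice d \<and>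
                 0 < sup_dist d x y \<and> sup_dist d x y \<le> int M}\<rparr>"

text \<open>The function \<open>z(i := z i + 1)\<close> is \<open>z\<close> plus the \<open>i\<close>-th standard basis vector.\<close>

definition comb_graph :: "nat \<Rightarrow> (nat \<Rightarrow> int) graph" where
  "comb_graph d =
     \<lparr>verts = lattice d,
      edges = {{z, z(i := z i + 1)} | z i. z \<in> lattice d \<and> 1 \<le> i \<and> i \<le> d - 1} \<union>
              {{z, z(d := z d + 1)} | z. z \<in> lattice d \<and> z 1 = 0}\<rparr>"

end

theory Submission imports Defs begin

text \<open>
  Fix \<open>p > 0\<close>. Grouping the sites into segments of \<open>L\<close> and calling a segment bad if it is closed
  produces a lattice whose points are bad independently with the small probability \<open>(1 - p) ^ L\<close>. It
  suffices to place the comb injectively on good points such that adjacent vertices are at distance at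
  most two; an open site from each segment then gives an embedding for every \<open>M \<ge> 3 * L\<close>.

  The teeth are level sets of one function \<open>level\<close> on the lattice. It is nondecreasing in direction
  \<open>d\<close>, constant on steps in this direction onto bad points, increases by at most two per step, and has
  Lipschitz level sets. Taking the levels \<open>2 * k\<close> leaves room for the teeth to be squeezed together
  around bad regions: on average one tooth for every two heights, but up to one for each height where
  necessary. The function is a first-passage time from the points where prescribing \<open>level v = v d\<close>
  leads to no contradiction (\<open>nice\<close>). A contradiction is a walk that starts at \<open>v\<close> and has a bad
  point for at least every second step, a \<open>hole\<close>. Hence the level agrees with the height at every
  point without a hole, and consecutive teeth are two apart there.

  The spine must therefore run along a Lipschitz surface of points without holes. Such a surface is the
  boundary of the \<open>flood\<close>, which rises from a half space in direction \<open>1\<close> by repeatedly taking in the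
  holes it touches and everything below them. If the flood reaches height \<open>h\<close> in some column, a walk
  along the responsible holes starts there, has length proportional to some \<open>R \<ge> h / 6\<close>, and meets
  at least \<open>R / 4\<close> distinct bad points (\<open>flood_dense_walk\<close>). As there are only exponentially many walks
  of a given length, a union bound over walks and columns shows that with positive probability the
  flood stays finite in all columns at once (\<open>no_dense_walk_positive\<close>).

  Finally the embedding event is measurable, since by compactness it is determined by partial
  embeddings of finite parts of the comb (\<open>embedding_event\<close>). So \<open>p\<close> is an upper bound for the
  critical probability once \<open>M \<ge> 3 * L\<close>.
\<close>

section \<open>Lattice points and king walks\<close>

definition near :: "nat \<Rightarrow> int \<Rightarrow> (nat \<Rightarrow> int) \<Rightarrow> (nat \<Rightarrow> int) \<Rightarrow> bool" where
  "near d m x y \<longleftrightarrow> (\<forall>i\<in>{1..d}. \<bar>x i - y i\<bar> \<le> m)"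

lemma near_refl: "0 \<le> m \<Longrightarrow> near d m x x"
  by (simp add: near_def)

lemma near_sym: "near d m x y \<Longrightarrow> near d m y x"
  by (simp add: near_def abs_minus_commute)

lemma near_trans:
  assumes "near d a x y" "near d b y z"
  shows "near d (a + b) x z"
  unfolding near_def
proof
  fix i assume "i \<in> {1..d}"
  then have "\<bar>x i - y i\<bar> \<le> a" "\<bar>y i - z i\<bar> \<le> b"
    using assms unfolding near_def by blast+
  then show "\<bar>x i - z i\<bar> \<le> a + b" by linarith
qed

lemma near_mono: "near d a x y \<Longrightarrow> a \<le> b \<Longrightarrow> near d b x y"
  unfolding near_def by force

lemma lattice_upd: "x \<in> lattice d \<Longrightarrow> i \<in> {1..d} \<Longrightarrow> x(i := a) \<in> lattice d"
  unfolding lattice_def by (auto simp: PiE_def extensional_def)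

lemma lattice_eqI: "x \<in> lattice d \<Longrightarrow> y \<in> lattice d \<Longrightarrow> (\<And>i. i \<in> {1..d} \<Longrightarrow> x i = y i) \<Longrightarrow> x = y"
  unfolding lattice_def by (rule PiE_ext)

lemma lattice_cube_eq_PiE:
  "{y \<in> lattice d. near d m x y} = (\<Pi>\<^sub>E i\<in>{1..d}. {x i - m..x i + m})"
proof -
  have "near d m x y \<longleftrightarrow> (\<forall>i\<in>{1..d}. y i \<in> {x i - m..x i + m})" for y
    unfolding near_def by (intro ball_cong refl) auto
  then show ?thesis unfolding lattice_def by (auto simp: PiE_iff extensional_def)
qed

lemma int_threshold:
  fixes P :: "int \<Rightarrow> bool"
  assumes "P a" "\<not> P b" "\<And>x y. x \<le> y \<Longrightarrow> P x \<Longrightarrow> P y"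
  shows "\<exists>!h. P h \<and> \<not> P (h - 1)"
proof -
  have "b \<le> a" using assms by (meson linear)
  then have "\<exists>h. P h \<and> \<not> P (h - 1)" using assms(1)
  proof (induction a rule: int_ge_induct)
    case base
    then show ?case using assms(2) by simp
  next
    case (step i)
    show ?case
    proof (cases "P i")
      case True
      then show ?thesis using step.IH by blast
    next
      case False
      then show ?thesis using step.prems by (intro exI[of _ "i + 1"]) simp
    qed
  qed
  moreover have "h = h'" if "P h \<and> \<not> P (h - 1)" "P h' \<and> \<not> P (h' - 1)" for h h'
    using that assms(3)[of h "h' - 1"] assms(3)[of h' "h - 1"] by linarith
  ultimately show ?thesis by blast
qed

text \<open>
  Walks move like a chess king: each step changes every coordinate by at most one. Steps that stay
  put are included, so a walk can be padded to any greater length.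
\<close>
definition walks :: "nat \<Rightarrow> nat \<Rightarrow> (nat \<Rightarrow> int) \<Rightarrow> (nat \<Rightarrow> int) list set" where
  "walks d n x = {xs. length xs = Suc n \<and> hd xs = x \<and> set xs \<subseteq> lattice d \<and> successively (near d 1) xs}"

lemma walks_0: "x \<in> lattice d \<Longrightarrow> walks d 0 x = {[x]}"
  by (auto simp: walks_def length_Suc_conv)

lemma walks_Suc:
  "walks d (Suc n) x = (if x \<in> lattice d then \<Union>y\<in>{y \<in> lattice d. near d 1 x y}. (#) x ` walks d n y else {})"
  by (auto simp: walks_def length_Suc_conv successively_Cons image_iff)

lemma walks_nonempty: "xs \<in> walks d n x \<Longrightarrow> xs \<noteq> []"
  by (auto simp: walks_def)

lemma walks_lattice: "xs \<in> walks d n x \<Longrightarrow> x \<in> lattice d"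
  by (metis (mono_tags, lifting) hd_in_set mem_Collect_eq subsetD walks_def walks_nonempty)

lemma walks_append:
  assumes "xs \<in> walks d m x" "ys \<in> walks d n (last xs)"
  shows "xs @ tl ys \<in> walks d (m + n) x" "set (xs @ tl ys) = set xs \<union> set ys"
    "last (xs @ tl ys) = last ys"
proof -
  obtain zs where ys: "ys = last xs # zs" using assms(2) by (cases ys) (auto simp: walks_def)
  have xs: "xs \<noteq> []" using assms walks_nonempty by blast
  show "xs @ tl ys \<in> walks d (m + n) x"
    using assms xs unfolding walks_def ys
    by (auto simp: successively_append_iff successively_Cons)
  show "set (xs @ tl ys) = set xs \<union> set ys" "last (xs @ tl ys) = last ys"
    using xs unfolding ys by auto
qed

lemma walk_between:
  assumes "x \<in> lattice d" "y \<in> lattice d" "near d (int m) x y"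
  shows "\<exists>xs\<in>walks d m x. last xs = y"
  using assms
proof (induction m arbitrary: x)
  case 0
  then have "x = y" by (intro lattice_eqI[of x d]) (auto simp: near_def)
  then show ?case using 0 by (auto simp: walks_0)
next
  case (Suc m)
  define w where "w = (\<lambda>i\<in>{1..d}. x i + sgn (y i - x i))"
  have w: "w \<in> lattice d" by (auto simp: w_def lattice_def)
  have xw: "near d 1 x w" by (auto simp: near_def w_def abs_sgn_eq)
  have "near d (int m) w y"
    unfolding near_def
  proof
    fix i assume i: "i \<in> {1..d}"
    then have "\<bar>x i - y i\<bar> \<le> int (Suc m)" using Suc.prems(3) unfolding near_def by blast
    then show "\<bar>w i - y i\<bar> \<le> int m" using i by (auto simp: w_def sgn_if)
  qed
  then obtain xs where xs: "xs \<in> walks d m w" "last xs = y" using Suc.IH w Suc.prems by blast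
  then have "x # xs \<in> walks d (Suc m) x" using xw w Suc.prems by (auto simp: walks_Suc)
  then show ?case using xs walks_nonempty[OF xs(1)] by (intro bexI[of _ "x # xs"]) auto
qed

lemma walk_near:
  assumes "xs \<in> walks d n x" "y \<in> set xs"
  shows "near d (int n) x y"
  using assms
proof (induction n arbitrary: x xs)
  case 0
  then show ?case using walks_lattice walks_0 by (fastforce simp: near_def)
next
  case (Suc n)
  then obtain w ys where w: "near d 1 x w" "ys \<in> walks d n w" "xs = x # ys"
    by (auto simp: walks_Suc split: if_splits)
  show ?case
  proof (cases "y = x")
    case False
    then have "near d (int n) w y" using Suc w by auto
    then show ?thesis using near_trans[OF w(1)] by auto
  qed (auto simp: near_def)
qed

lemma card_walks: "finite (walks d n x) \<and> card (walks d n x) \<le> (3 ^ d) ^ n"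
proof (induction n arbitrary: x)
  case 0
  have "walks d 0 x \<subseteq> {[x]}" by (auto simp: walks_def length_Suc_conv)
  then show ?case using card_mono[of "{[x]}" "walks d 0 x"] by (auto intro: finite_subset)
next
  case (Suc n)
  define N where "N = {y \<in> lattice d. near d 1 x y}"
  have N: "N = PiE {1..d} (\<lambda>i. {x i - 1..x i + 1})"
    unfolding N_def by (rule lattice_cube_eq_PiE)
  have fN: "finite N" unfolding N by (intro finite_PiE) auto
  have cN: "card N = 3 ^ d" unfolding N by (subst card_PiE) auto
  have sub: "walks d (Suc n) x \<subseteq> (\<Union>y\<in>N. (#) x ` walks d n y)"
    by (auto simp: walks_Suc N_def split: if_splits)
  have fin: "finite (\<Union>y\<in>N. (#) x ` walks d n y)" using fN Suc by auto
  have "card (walks d (Suc n) x) \<le> card (\<Union>y\<in>N. (#) x ` walks d n y)"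
    by (rule card_mono[OF fin sub])
  also have "\<dots> \<le> (\<Sum>y\<in>N. card ((#) x ` walks d n y))" by (rule card_UN_le[OF fN])
  also have "\<dots> \<le> (\<Sum>y\<in>N. (3 ^ d) ^ n)"
    by (intro sum_mono) (meson Suc card_image_le le_trans)
  also have "\<dots> = (3 ^ d) ^ Suc n" by (simp add: cN)
  finally show ?case using finite_subset[OF sub fin] by auto
qed

section \<open>The level function\<close>

locale bad_sites =
  fixes d :: nat and B :: "(nat \<Rightarrow> int) set"
  assumes two_le_d: "2 \<le> d"
begin

text \<open>
  Steps in direction \<open>d\<close> onto a bad point earn one unit, and all others cost one. Around a closed
  walk the earnings cannot exceed the costs, because every upward step is undone by another step.
\<close>
fun cost :: "(nat \<Rightarrow> int) list \<Rightarrow> int" where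
  "cost (x # y # zs) = (if y = x(d := x d + 1) \<and> y \<in> B then -1 else 1) + cost (y # zs)"
| "cost _ = 0"

lemma cost_append:
  "xs \<noteq> [] \<Longrightarrow> cost (xs @ zs) = cost xs + cost (last xs # zs)"
  by (induction xs rule: cost.induct) auto

lemma cost_le: "xs \<in> walks d n x \<Longrightarrow> cost xs \<le> int n"
proof (induction xs arbitrary: n x rule: cost.induct)
  case (1 a y zs)
  then obtain m where m: "n = Suc m" by (auto simp: walks_def)
  then have "y # zs \<in> walks d m y" using 1(2) by (auto simp: walks_def)
  then show ?case using 1(1) m by fastforce
qed (auto simp: walks_def)

lemma cost_climb:
  "xs \<noteq> [] \<Longrightarrow> successively (near d 1) xs \<Longrightarrow> hd xs d - last xs d \<le> cost xs"
proof (induction xs rule: cost.induct)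
  case (1 x y zs)
  have "\<bar>x d - y d\<bar> \<le> 1" using 1(3) two_le_d by (auto simp: near_def)
  then show ?case using 1 by (auto split: if_splits)
qed auto

lemma cost_distinct:
  "distinct (x # zs) \<Longrightarrow> int (length zs) - 2 * int (card (set zs \<inter> B)) \<le> cost (x # zs)"
proof (induction zs arbitrary: x)
  case (Cons y zs)
  have "card (set (y # zs) \<inter> B) = (if y \<in> B then 1 else 0) + card (set zs \<inter> B)"
    using Cons.prems by (auto simp: Int_insert_left)
  then show ?case using Cons.IH[of y] Cons.prems by auto
qed auto

text \<open>
  Walks of nonnegative cost are what makes \<open>level v = v d\<close> consistent at the starting point \<open>v\<close>:
  no chain of constraints that starts at \<open>v\<close> forces a smaller value there.
\<close>
definition nice :: "(nat \<Rightarrow> int) \<Rightarrow> bool" where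
  "nice v \<longleftrightarrow> v \<in> lattice d \<and> (\<forall>n. \<forall>xs\<in>walks d n v. 0 \<le> cost xs)"

text \<open>
  A shortest walk of negative cost has no repeated point, since cutting out a closed loop does not
  increase the cost. It therefore earns at most once per bad point, and more than half of its steps
  end at distinct bad points. This turns a statement about earnings into one about density of bad
  points, which can be bounded by counting walks.
\<close>
lemma not_nice_walk:
  assumes "v \<in> lattice d" "\<not> nice v"
  shows "\<exists>n xs. xs \<in> walks d n v \<and> 1 \<le> n \<and> n < 2 * card (set xs \<inter> B)"
proof -
  define P where "P n \<longleftrightarrow> (\<exists>xs\<in>walks d n v. cost xs < 0)" for n
  have "\<exists>n. P n" using assms unfolding nice_def P_def by fastforce
  then obtain n where n: "P n" "\<And>m. m < n \<Longrightarrow> \<not> P m" by (metis LeastI not_less_Least)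
  then obtain xs where xs: "xs \<in> walks d n v" "cost xs < 0" unfolding P_def by blast
  have "distinct xs"
  proof (rule ccontr)
    assume "\<not> distinct xs"
    then obtain as bs cs y where dec: "xs = as @ [y] @ bs @ [y] @ cs"
      using not_distinct_decomp by blast
    define ys where "ys = (as @ [y]) @ cs"
    have succ: "successively (near d 1) xs" using xs by (auto simp: walks_def)
    have loop: "0 \<le> cost (y # bs @ [y])"
    proof -
      have "successively (near d 1) (y # bs @ [y])"
      proof -
        have "xs = as @ (y # bs @ [y]) @ cs" unfolding dec by simp
        then show ?thesis using succ by (simp only: successively_append_iff)
      qed
      then show ?thesis using cost_climb[of "y # bs @ [y]"] by simp
    qed
    have e: "xs = (as @ [y]) @ (bs @ [y]) @ cs" unfolding dec by simp
    have "cost xs = cost (as @ [y]) + cost (y # (bs @ [y]) @ cs)"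
      unfolding e by (subst cost_append) auto
    also have "cost (y # (bs @ [y]) @ cs) = cost (y # bs @ [y]) + cost (y # cs)"
      using cost_append[of "y # bs @ [y]" cs] by simp
    finally have "cost ys \<le> cost xs"
      using loop unfolding ys_def by (subst cost_append) auto
    moreover have "ys \<in> walks d (n - Suc (length bs)) v"
    proof -
      have "successively (near d 1) ys" using succ unfolding ys_def dec
        by (auto simp: successively_append_iff successively_Cons)
      moreover have "hd ys = hd xs" unfolding ys_def dec by (cases as) auto
      ultimately show ?thesis using xs unfolding walks_def ys_def dec by auto
    qed
    moreover have "n - Suc (length bs) < n" using xs unfolding dec walks_def by auto
    ultimately show False using n(2) xs(2) unfolding P_def by (meson le_less_trans)
  qed
  moreover obtain zs where zs: "xs = v # zs" "length zs = n"
    using xs(1) by (cases xs) (auto simp: walks_def)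
  ultimately have "int n - 2 * int (card (set zs \<inter> B)) < 0"
    using cost_distinct[of v zs] xs(2) by auto
  moreover have "card (set zs \<inter> B) \<le> card (set xs \<inter> B)"
    by (intro card_mono) (auto simp: zs)
  moreover have "1 \<le> n" using xs zs by (cases zs) auto
  ultimately show ?thesis using xs(1) by (intro exI[of _ n] exI[of _ xs]) linarith
qed

text \<open>
  The minimum is over natural numbers because nice points have no outgoing walk of negative cost.
\<close>
definition excess :: "(nat \<Rightarrow> int) \<Rightarrow> nat" where
  "excess x = (LEAST k. \<exists>v n xs. nice v \<and> xs \<in> walks d n v \<and> last xs = x \<and> cost xs = int k)"

text \<open>
  The level sets of this function are the teeth of the comb. It is a first-passage time from the
  nice points, corrected by the height: going up costs two on good points and nothing on bad ones,
  and moving sideways while going down is free. Consequently \<open>level\<close> is constant across bad points,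
  never grows faster than two per step, and its level sets are Lipschitz graphs.
\<close>
definition level :: "(nat \<Rightarrow> int) \<Rightarrow> int" where
  "level x = x d + int (excess x)"

lemma excess_le:
  assumes "nice v" "xs \<in> walks d n v" "last xs = x"
  shows "int (excess x) \<le> cost xs"
proof -
  have "0 \<le> cost xs" using assms nice_def by blast
  then have "excess x \<le> nat (cost xs)"
    unfolding excess_def using assms by (intro Least_le) (metis nat_0_le)
  then show ?thesis using \<open>0 \<le> cost xs\<close> by linarith
qed

lemma excess_attained:
  assumes "nice v0" "x \<in> lattice d"
  shows "\<exists>v n xs. nice v \<and> xs \<in> walks d n v \<and> last xs = x \<and> cost xs = int (excess x)"
proof -
  have v0: "v0 \<in> lattice d" using assms nice_def by blast
  define m where "m = nat (\<Sum>i\<in>{1..d}. \<bar>v0 i - x i\<bar>)"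
  have "near d (int m) v0 x" unfolding near_def m_def
    by (auto intro!: member_le_sum sum_nonneg)
  then obtain xs where xs: "xs \<in> walks d m v0" "last xs = x"
    using walk_between v0 assms by blast
  have "0 \<le> cost xs" using xs assms nice_def by blast
  then have "\<exists>k v n xs. nice v \<and> xs \<in> walks d n v \<and> last xs = x \<and> cost xs = int k"
    using xs assms(1) by (metis nat_0_le)
  then show ?thesis unfolding excess_def by (rule LeastI_ex)
qed

lemma excess_nice: "nice v \<Longrightarrow> excess v = 0"
  using excess_le[of v "[v]" 0 v] by (auto simp: nice_def walks_0)

lemma excess_lipschitz:
  assumes "nice v0" "x \<in> lattice d" "y \<in> lattice d" "near d (int m) x y"
  shows "excess y \<le> excess x + m"
proof -
  obtain v n xs where xs: "nice v" "xs \<in> walks d n v" "last xs = x" "cost xs = int (excess x)"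
    using excess_attained assms by blast
  obtain ys where ys: "ys \<in> walks d m x" "last ys = y" using walk_between assms by blast
  have e: "ys = x # tl ys" using ys by (cases ys) (auto simp: walks_def)
  have "int (excess y) \<le> cost (xs @ tl ys)"
    using walks_append[OF xs(2), of ys m] ys xs excess_le by metis
  also have "\<dots> = cost xs + cost ys"
    using cost_append[of xs "tl ys"] walks_nonempty[OF xs(2)] xs(3) e by simp
  also have "\<dots> \<le> int (excess x + m)" using cost_le[OF ys(1)] xs by simp
  finally show ?thesis by simp
qed

lemma excess_bad:
  assumes "nice v0" "x \<in> lattice d" "x(d := x d + 1) \<in> B"
  shows "int (excess (x(d := x d + 1))) \<le> int (excess x) - 1"
proof -
  let ?y = "x(d := x d + 1)"
  obtain v n xs where xs: "nice v" "xs \<in> walks d n v" "last xs = x" "cost xs = int (excess x)"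
    using excess_attained assms by blast
  have y: "?y \<in> lattice d" using lattice_upd assms two_le_d by auto
  have "[x, ?y] \<in> walks d 1 (last xs)" using xs assms y by (auto simp: walks_def near_def)
  note w = walks_append[OF xs(2) this]
  have "int (excess ?y) \<le> cost (xs @ tl [x, ?y])"
    using w xs(1) by (intro excess_le) auto
  also have "\<dots> = cost xs + cost [x, ?y]"
    using cost_append[of xs "[?y]"] walks_nonempty[OF xs(2)] xs(3) by simp
  finally show ?thesis using xs assms by simp
qed

lemma level_nice: "nice v \<Longrightarrow> level v = v d"
  by (simp add: level_def excess_nice)

text \<open>
  A king walk of \<open>m\<close> steps costs at most \<open>m\<close>, and the height gain of at least \<open>m\<close> pays for it. This
  is what makes the level sets Lipschitz.
\<close>
lemma level_cone:
  assumes "nice v0" "x \<in> lattice d" "y \<in> lattice d" "near d (int m) x y" "x d + int m \<le> y d"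
  shows "level x \<le> level y"
  using excess_lipschitz[of v0 y x m] assms near_sym[OF assms(4)] unfolding level_def by auto

lemma level_Suc:
  assumes "nice v0" "x \<in> lattice d"
  shows "level x \<le> level (x(d := x d + 1))" "level (x(d := x d + 1)) \<le> level x + 2"
    "x(d := x d + 1) \<in> B \<Longrightarrow> level (x(d := x d + 1)) = level x"
proof -
  let ?y = "x(d := x d + 1)"
  have y: "?y \<in> lattice d" using lattice_upd assms two_le_d by auto
  have n: "near d (int 1) x ?y" by (auto simp: near_def)
  show 1: "level x \<le> level ?y" using level_cone[OF assms y n] by auto
  show "level ?y \<le> level x + 2"
    using excess_lipschitz[OF assms y n] by (auto simp: level_def)
  show "?y \<in> B \<Longrightarrow> level ?y = level x"
    using excess_bad[OF assms] 1 by (auto simp: level_def)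
qed

end

section \<open>A Lipschitz surface without holes\<close>

context bad_sites
begin

text \<open>
  The points below \<open>y\<close> form a cone of slope one with apex \<open>y\<close>, opening against direction \<open>1\<close>. A set
  closed under passing to points below, nonempty and bounded above in each column, is the region under
  the graph of a Lipschitz function of the coordinates \<open>2, \<dots>, d\<close>.
\<close>
definition below :: "(nat \<Rightarrow> int) \<Rightarrow> (nat \<Rightarrow> int) \<Rightarrow> bool" where
  "below x y \<longleftrightarrow> near d (y 1 - x 1) x y"

lemma below_refl: "below x x"
  by (simp add: below_def near_refl)

lemma below_trans: "below x y \<Longrightarrow> below y z \<Longrightarrow> below x z"
  unfolding below_def using near_trans[of d "y 1 - x 1" x y "z 1 - y 1" z] by simp

lemma below_le: "below x y \<Longrightarrow> x 1 \<le> y 1"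
  using two_le_d by (force simp: below_def near_def)

text \<open>
  Half the points being bad suffices, rather than more than half: then a walk of negative cost from
  a point \<open>v\<close>, or from the point before \<open>v\<close> in direction \<open>d\<close>, yields a hole that starts at \<open>v\<close>.
\<close>
definition hole :: "nat \<Rightarrow> (nat \<Rightarrow> int) list \<Rightarrow> bool" where
  "hole r xs \<longleftrightarrow> 1 \<le> r \<and> xs \<in> walks d r (hd xs) \<and> r \<le> 2 * card (set xs \<inter> B)"

definition cube :: "nat \<Rightarrow> (nat \<Rightarrow> int) \<Rightarrow> (nat \<Rightarrow> int) set" where
  "cube r v = {y \<in> lattice d. near d (int r) v y}"

text \<open>
  Starting from the half space \<open>x 1 \<le> 0\<close>, the flood takes in each cube spanned by a hole that it
  touches, together with all points below. If it stays finite in every column, its surface is a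
  Lipschitz graph on which no hole starts. Since stage zero is empty, the half space consists of points
  that are first flooded at stage one, which is the base case of inductions over the stages.
\<close>
fun flood :: "nat \<Rightarrow> (nat \<Rightarrow> int) set" where
  "flood 0 = {}"
| "flood (Suc k) = {x \<in> lattice d. x 1 \<le> 0 \<or>
     (\<exists>r xs. hole r xs \<and> cube r (hd xs) \<inter> flood k \<noteq> {} \<and> (\<exists>y\<in>cube r (hd xs). below x y))}"

lemma flood_Suc_mono: "flood k \<subseteq> flood (Suc k)"
proof (induction k)
  case (Suc k)
  then have "cube r v \<inter> flood k \<noteq> {} \<Longrightarrow> cube r v \<inter> flood (Suc k) \<noteq> {}" for r v
    by blast
  then show ?case unfolding flood.simps(2)[of "Suc k"] by (subst flood.simps(2)) blast
qed simp

lemma flood_mono: "k \<le> l \<Longrightarrow> flood k \<subseteq> flood l"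
  by (rule lift_Suc_mono_le[of flood, OF flood_Suc_mono])

lemma flood_lattice: "flood k \<subseteq> lattice d"
  by (cases k) auto

lemma flood_below: "y \<in> flood k \<Longrightarrow> x \<in> lattice d \<Longrightarrow> below x y \<Longrightarrow> x \<in> flood k"
proof (cases k)
  case (Suc l)
  assume y: "y \<in> flood k" and x: "x \<in> lattice d" and xy: "below x y"
  show ?thesis
  proof (cases "y 1 \<le> 0")
    case True
    then show ?thesis using below_le[OF xy] x by (simp add: Suc)
  next
    case False
    then obtain r xs w where "hole r xs" "cube r (hd xs) \<inter> flood l \<noteq> {}"
      "w \<in> cube r (hd xs)" "below y w"
      using y unfolding Suc flood.simps by blast
    then show ?thesis using below_trans[OF xy] x unfolding Suc flood.simps by blast
  qed
qed simp

lemma flood_hole: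
  assumes "hole r xs" "cube r (hd xs) \<inter> flood k \<noteq> {}"
  shows "cube r (hd xs) \<subseteq> flood (Suc k)"
  using assms below_refl by (auto simp: cube_def)

text \<open>
  Outside the half space, a point first flooded at stage \<open>Suc k\<close> is reached through a hole whose cube
  touches stage \<open>k\<close> but no earlier stage. Hence that hole shares no points with the holes two or
  more stages before. Walking back from hole to hole down to the half space collects the bad points of alternate holes in the two
  sets \<open>A\<close> and \<open>A'\<close>; each is a disjoint union, so its cardinality is at least half the total length
  of its holes. The height bounds the length of the walk between holes, because moving to a point
  above it in the cone order takes as many steps as it gains in height. The factor six splits into two
  radii for the rise inside a cube and four for crossing it by way of the hole.
\<close>
lemma flood_walk:
  assumes "x \<in> flood (Suc k)" "x \<notin> flood k"
  shows "\<exists>n xs A A' a a'. xs \<in> walks d n x \<and> A \<union> A' \<subseteq> set xs \<inter> B \<and> A \<subseteq> flood (Suc k) \<and> A' \<subseteq> flood k \<and>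
     a \<le> 2 * card A \<and> a' \<le> 2 * card A' \<and> int n + x 1 \<le> 6 * int (a + a')"
  using assms
proof (induction k arbitrary: x)
  case 0
  then have "[x] \<in> walks d 0 x" "x 1 \<le> 0" by (auto simp: walks_0)
  then show ?case
    by (intro exI[of _ 0] exI[of _ "[x]"] exI[of _ "{}"] exI[of _ "0::nat"]) auto
next
  case (Suc k)
  have x: "x \<in> lattice d" using Suc.prems flood_lattice by blast
  have x1: "\<not> x 1 \<le> 0" using Suc.prems x by auto
  then obtain r xs y where h: "hole r xs" "cube r (hd xs) \<inter> flood (Suc k) \<noteq> {}"
    "y \<in> cube r (hd xs)" "below x y"
    using Suc.prems(1) by (subst (asm) flood.simps) blast
  then obtain w where w: "w \<in> cube r (hd xs)" "w \<in> flood (Suc k)" by blast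
  have dis: "cube r (hd xs) \<inter> flood k = {}"
  proof (rule ccontr)
    assume "cube r (hd xs) \<inter> flood k \<noteq> {}"
    then have "x \<in> flood (Suc k)" using h x unfolding flood.simps(2)[of k] by blast
    then show False using Suc.prems by simp
  qed
  then have "w \<notin> flood k" using w by blast
  with Suc.IH[OF w(2)] obtain n ws A A' a a' where
    IH: "ws \<in> walks d n w" "A \<union> A' \<subseteq> set ws \<inter> B" "A \<subseteq> flood (Suc k)" "A' \<subseteq> flood k"
     "a \<le> 2 * card A" "a' \<le> 2 * card A'" "int n + w 1 \<le> 6 * int (a + a')" by blast
  let ?v = "hd xs"
  have hw: "xs \<in> walks d r ?v" using h hole_def by blast
  have v: "?v \<in> lattice d" using hw walks_lattice by blast
  have y: "y \<in> lattice d" using h cube_def by blast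
  \<comment> \<open>The walk goes from \<open>x\<close> up to \<open>y\<close> and to the start of the hole (\<open>p\<close>), through the hole (\<open>xs\<close>),
    from its end to \<open>w\<close> (\<open>q\<close>), and on to the half space (\<open>ws\<close>).\<close>
  define m where "m = nat (y 1 - x 1)"
  have m: "int m = y 1 - x 1" using below_le[OF h(4)] by (simp add: m_def)
  have "near d (int m) x y" using h(4) unfolding below_def m by simp
  moreover have "near d (int r) y ?v" using h(3) near_sym unfolding cube_def by blast
  ultimately have "near d (int (m + r)) x ?v" using near_trans by fastforce
  then obtain p where p: "p \<in> walks d (m + r) x" "last p = ?v" using walk_between x v by blast
  have last: "last xs \<in> lattice d" "near d (int r) ?v (last xs)"
    using hw walk_near[OF hw] walks_nonempty[OF hw] unfolding walks_def by auto
  have "near d (int (r + r)) (last xs) w"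
    using near_trans[OF near_sym[OF last(2)], of "int r" w] w(1) unfolding cube_def by simp
  moreover have wl: "w \<in> lattice d" using w(1) cube_def by blast
  ultimately obtain q where q: "q \<in> walks d (r + r) (last xs)" "last q = w"
    using walk_between last(1) by blast
  define p1 where "p1 = p @ tl xs"
  define p2 where "p2 = p1 @ tl q"
  define p3 where "p3 = p2 @ tl ws"
  have p1: "p1 \<in> walks d (m + r + r) x" "set p1 = set p \<union> set xs" "last p1 = last xs"
    using walks_append[OF p(1), of xs r] hw p unfolding p1_def by auto
  have p2: "p2 \<in> walks d (m + r + r + (r + r)) x" "set p2 = set p1 \<union> set q" "last p2 = w"
    using walks_append[OF p1(1), of q "r + r"] q p1 unfolding p2_def by auto
  have p3: "p3 \<in> walks d (m + r + r + (r + r) + n) x" "set p3 = set p2 \<union> set ws"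
    using walks_append[OF p2(1), of ws n] IH(1) p2 unfolding p3_def by auto
  define C where "C = set xs \<inter> B"
  have Ccube: "C \<subseteq> cube r ?v"
    using walk_near[OF hw] hw unfolding C_def cube_def walks_def by blast
  have CA: "C \<inter> A' = {}" using Ccube dis IH(4) by blast
  have fin: "finite C" "finite A'" unfolding C_def
    using IH(2) by (auto intro: finite_subset[of _ "set ws"])
  have card: "card (C \<union> A') = card C + card A'" using CA fin by (simp add: card_Un_disjoint)
  have "C \<union> A' \<subseteq> flood (Suc (Suc k))"
    using Ccube flood_hole[OF h(1,2)] IH(4) flood_mono[of k "Suc (Suc k)"] by auto
  moreover have "r \<le> 2 * card C" using h(1) unfolding hole_def C_def by blast
  then have "r + a' \<le> 2 * card (C \<union> A')" using IH(6) unfolding card by simp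
  moreover have "(C \<union> A') \<union> A \<subseteq> set p3 \<inter> B" using IH(2) p3(2) p2(2) p1(2) unfolding C_def by blast
  moreover have "y 1 \<le> w 1 + 2 * int r"
  proof -
    have "near d (int (r + r)) y w"
      using near_trans[of d "int r" y ?v "int r" w] h(3) w(1) near_sym unfolding cube_def by simp
    then show ?thesis using two_le_d by (force simp: near_def)
  qed
  then have "int (m + r + r + (r + r) + n) + x 1 \<le> 6 * int (r + a' + a)" using m IH(7) by simp
  ultimately show ?case using p3(1) IH(3,5) by blast
qed

text \<open>
  One of the two alternating sets carries at least half of the total hole length, hence at least
  \<open>R / 4\<close> bad points. The walk is padded by standing still to make its length depend on \<open>R\<close> only.
\<close>
lemma flood_dense_walk:
  assumes "x \<in> flood k" "x 1 = 6 * (1 + int i)"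
  shows "\<exists>R\<ge>Suc i. \<exists>xs\<in>walks d (6 * R) x. R \<le> 4 * card (set xs \<inter> B)"
proof -
  define j where "j = (LEAST k. x \<in> flood k)"
  have j: "x \<in> flood j" unfolding j_def by (rule LeastI[of "\<lambda>k. x \<in> flood k", OF assms(1)])
  then obtain l where l: "j = Suc l" by (cases j) auto
  have "x \<notin> flood l" using not_less_Least[of l "\<lambda>k. x \<in> flood k"] l unfolding j_def by auto
  with flood_walk[of x l] j l obtain n xs A A' a a' where
    w: "xs \<in> walks d n x" "A \<union> A' \<subseteq> set xs \<inter> B"
     "a \<le> 2 * card A" "a' \<le> 2 * card A'" "int n + x 1 \<le> 6 * int (a + a')" by blast
  define R where "R = a + a'"
  have R: "Suc i \<le> R" "n \<le> 6 * R" using w(5) assms(2) unfolding R_def by auto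
  have last: "last xs \<in> lattice d"
    using w(1) walks_nonempty[OF w(1)] unfolding walks_def by auto
  obtain ys where ys: "ys \<in> walks d (6 * R - n) (last xs)"
    using walk_between[OF last last, of "6 * R - n"] near_refl by auto
  note z = walks_append[OF w(1) ys]
  let ?zs = "xs @ tl ys"
  have "card A \<le> card (set ?zs \<inter> B)" "card A' \<le> card (set ?zs \<inter> B)"
    using w(2) z(2) by (auto intro!: card_mono)
  then have "R \<le> 4 * card (set ?zs \<inter> B)" using w(3,4) unfolding R_def by linarith
  moreover have "?zs \<in> walks d (6 * R) x" using z(1) R(2) by simp
  ultimately show ?thesis using R(1) by blast
qed

end

section \<open>Placing the comb on good points\<close>

context bad_sites
begin

definition wet :: "(nat \<Rightarrow> int) \<Rightarrow> bool" where
  "wet x \<longleftrightarrow> (\<exists>k. x \<in> flood k)"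

lemma wet_below: "wet y \<Longrightarrow> x \<in> lattice d \<Longrightarrow> below x y \<Longrightarrow> wet x"
  unfolding wet_def using flood_below by blast

definition spine :: "(nat \<Rightarrow> int) \<Rightarrow> int" where
  "spine x = (THE h. \<not> wet (x(1 := h)) \<and> wet (x(1 := h - 1)))"

text \<open>
  The height at which \<open>level\<close> reaches \<open>2 * k\<close>. Since \<open>level\<close> may rise by two in one step, only every
  second value is used; then different layers have different heights.
\<close>
definition layer :: "int \<Rightarrow> (nat \<Rightarrow> int) \<Rightarrow> int" where
  "layer k x = (THE h. 2 * k \<le> level (x(d := h)) \<and> level (x(d := h - 1)) < 2 * k)"

text \<open>
  The comb is first sheared in direction \<open>1\<close>, which puts its spine onto the surface of the flood;
  then each tooth is bent in direction \<open>d\<close> to follow its level set.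
\<close>
definition place :: "(nat \<Rightarrow> int) \<Rightarrow> nat \<Rightarrow> int" where
  "place z = (let p = z(1 := z 1 + spine (z(d := 2 * z d))) in p(d := layer (z d) p))"

end

locale drained = bad_sites +
  assumes dry: "c \<in> lattice d \<Longrightarrow> \<exists>a. \<not> wet (c(1 := a))"
begin

lemma upd_1: "x \<in> lattice d \<Longrightarrow> x(1 := a) \<in> lattice d"
  and upd_d: "x \<in> lattice d \<Longrightarrow> x(d := a) \<in> lattice d"
  using two_le_d by (auto intro!: lattice_upd)

lemma spine:
  assumes x: "x \<in> lattice d"
  shows "\<not> wet (x(1 := spine x))" "wet (x(1 := spine x - 1))"
proof -
  obtain a where a: "\<not> wet (x(1 := a))" using dry x by blast
  have b: "wet (x(1 := 0))"
    unfolding wet_def by (intro exI[of _ 1]) (simp add: upd_1[OF x, simplified])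
  have "\<exists>!h. \<not> wet (x(1 := h)) \<and> \<not> \<not> wet (x(1 := h - 1))"
  proof (rule int_threshold[where P = "\<lambda>h. \<not> wet (x(1 := h))", OF a])
    show "\<not> \<not> wet (x(1 := 0))" using b by simp
    fix h h' :: int assume h: "h \<le> h'" "\<not> wet (x(1 := h))"
    have "below (x(1 := h)) (x(1 := h'))" using h by (auto simp: below_def near_def)
    then show "\<not> wet (x(1 := h'))" using wet_below upd_1[OF x] h by blast
  qed
  then have "\<exists>!h. \<not> wet (x(1 := h)) \<and> wet (x(1 := h - 1))" by simp
  from theI'[OF this] show "\<not> wet (x(1 := spine x))" "wet (x(1 := spine x - 1))"
    unfolding spine_def by blast+
qed

lemma spine_lipschitz:
  assumes x: "x \<in> lattice d" and y: "y \<in> lattice d"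
    and xy: "near d m (x(1 := 0)) (y(1 := 0))"
  shows "\<bar>spine x - spine y\<bar> \<le> m"
proof -
  have *: "spine y \<le> spine x + m"
    if x: "x \<in> lattice d" and y: "y \<in> lattice d"
    and xy: "near d m (x(1 := 0)) (y(1 := 0))" for x y
  proof (rule ccontr)
    assume less: "\<not> spine y \<le> spine x + m"
    have "0 \<le> m" using xy two_le_d unfolding near_def by force
    have "below (x(1 := spine x)) (y(1 := spine y - 1))"
      unfolding below_def near_def
    proof
      fix i assume "i \<in> {1..d}"
      then have "\<bar>(x(1 := 0)) i - (y(1 := 0)) i\<bar> \<le> m" using xy unfolding near_def by blast
      then show "\<bar>(x(1 := spine x)) i - (y(1 := spine y - 1)) i\<bar>
        \<le> (y(1 := spine y - 1)) 1 - (x(1 := spine x)) 1"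
        using less \<open>0 \<le> m\<close> by (cases "i = 1") auto
    qed
    then show False using wet_below[OF spine(2)[OF y]] upd_1[OF x] spine(1)[OF x] by blast
  qed
  show ?thesis using *[OF x y xy] *[OF y x near_sym[OF xy]] by linarith
qed

text \<open>
  The point just under the surface is flooded and lies in the cube of any hole that starts on the
  surface, so the flood would have swallowed this cube.
\<close>
lemma spine_not_hole:
  assumes x: "x \<in> lattice d" and v: "v = x(1 := spine x)"
  shows "\<not> (xs \<in> walks d r v \<and> 1 \<le> r \<and> r \<le> 2 * card (set xs \<inter> B))"
proof
  assume h: "xs \<in> walks d r v \<and> 1 \<le> r \<and> r \<le> 2 * card (set xs \<inter> B)"
  then have hd: "hd xs = v" by (simp add: walks_def)
  have hole: "hole r xs" using h hd by (simp add: hole_def)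
  obtain k where k: "x(1 := spine x - 1) \<in> flood k" using spine(2)[OF x] wet_def by blast
  have "near d (int r) v (x(1 := spine x - 1))" using h by (auto simp: v near_def)
  then have "cube r (hd xs) \<inter> flood k \<noteq> {}"
    using k upd_1[OF x] unfolding hd cube_def by blast
  then have "cube r (hd xs) \<subseteq> flood (Suc k)" using flood_hole hole by blast
  moreover have "v \<in> cube r (hd xs)" using upd_1[OF x] hd by (simp add: v cube_def near_refl)
  ultimately show False using spine(1)[OF x] unfolding v wet_def by blast
qed

text \<open>
  Niceness of \<open>v\<close> alone gives \<open>level v = v d\<close>; that of the preceding point in direction \<open>d\<close> shows
  that this level is not attained before \<open>v\<close>.
\<close>
lemma spine_nice:
  assumes x: "x \<in> lattice d" and v: "v = x(1 := spine x)"
  shows "nice v" "nice (v(d := v d - 1))"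
proof -
  have vl: "v \<in> lattice d" using upd_1[OF x] v by simp
  show "nice v"
  proof (rule ccontr)
    assume "\<not> nice v"
    then obtain n xs where "xs \<in> walks d n v" "1 \<le> n" "n < 2 * card (set xs \<inter> B)"
      using not_nice_walk vl by blast
    then show False using spine_not_hole[OF x v, of xs n] by simp
  qed
  let ?w = "v(d := v d - 1)"
  show "nice ?w"
  proof (rule ccontr)
    assume "\<not> nice ?w"
    then obtain n xs where xs: "xs \<in> walks d n ?w" "1 \<le> n" "n < 2 * card (set xs \<inter> B)"
      using not_nice_walk upd_d[OF vl] by blast
    have "v # xs \<in> walks d (Suc n) v"
      using xs(1) vl upd_d[OF vl, of "v d - 1"] by (auto simp: walks_Suc near_def)
    moreover have "card (set xs \<inter> B) \<le> card (set (v # xs) \<inter> B)"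
      by (intro card_mono) auto
    ultimately show False using spine_not_hole[OF x v, of "v # xs" "Suc n"] xs by simp
  qed
qed

lemma ex_nice: "\<exists>v. nice v"
  using spine_nice(1)[of "\<lambda>i\<in>{1..d}. 0"] by (auto simp: lattice_def)

lemma level_vertical_mono:
  assumes x: "x \<in> lattice d" and "h \<le> h'"
  shows "level (x(d := h)) \<le> level (x(d := h'))"
proof -
  obtain v0 where v0: "nice v0" using ex_nice by blast
  show ?thesis
    by (rule level_cone[OF v0 upd_d[OF x] upd_d[OF x], of "nat (h' - h)"])
      (use assms(2) in \<open>auto simp: near_def\<close>)
qed

text \<open>
  The level is at least the height, which bounds the layer from above. From below it is bounded by a
  point of the spine at height \<open>2 * k - 2\<close>, whose level is known, and the cone underneath it.
\<close>
lemma layer_unique: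
  assumes x: "x \<in> lattice d"
  shows "\<exists>!h. 2 * k \<le> level (x(d := h)) \<and> level (x(d := h - 1)) < 2 * k"
proof -
  obtain v0 where v0: "nice v0" using ex_nice by blast
  define s where "s = x(d := 2 * k - 2)"
  define p where "p = s(1 := spine s)"
  have s: "s \<in> lattice d" and p: "p \<in> lattice d"
    using x upd_d upd_1 unfolding s_def p_def by auto
  define m where "m = nat \<bar>x 1 - spine s\<bar>"
  have "level (x(d := 2 * k - 2 - int m)) \<le> level p"
    by (rule level_cone[OF v0 upd_d[OF x] p, of m])
      (use two_le_d in \<open>auto simp: near_def p_def s_def m_def\<close>)
  also have "level p = 2 * k - 2"
    using level_nice[OF spine_nice(1)[OF s p_def]] two_le_d by (simp add: p_def s_def)
  finally have b: "\<not> 2 * k \<le> level (x(d := 2 * k - 2 - int m))" by simp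
  have a: "2 * k \<le> level (x(d := 2 * k))" by (simp add: level_def)
  have "\<exists>!h. 2 * k \<le> level (x(d := h)) \<and> \<not> 2 * k \<le> level (x(d := h - 1))"
    by (rule int_threshold[where P = "\<lambda>h. 2 * k \<le> level (x(d := h))", OF a b]) (use level_vertical_mono[OF x] in \<open>meson order_trans\<close>)
  then show ?thesis by (simp add: not_le)
qed

lemma layer:
  assumes "x \<in> lattice d"
  shows "2 * k \<le> level (x(d := layer k x))" "level (x(d := layer k x - 1)) < 2 * k"
  using theI'[OF layer_unique[OF assms, of k]] unfolding layer_def by blast+

lemma layer_eq:
  assumes "x \<in> lattice d" "2 * k \<le> level (x(d := h))" "level (x(d := h - 1)) < 2 * k"
  shows "layer k x = h"
  unfolding layer_def using the1_equality[OF layer_unique[OF assms(1), of k]] assms by blast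

lemma layer_not_bad:
  assumes x: "x \<in> lattice d"
  shows "x(d := layer k x) \<notin> B"
proof
  assume bad: "x(d := layer k x) \<in> B"
  obtain v0 where v0: "nice v0" using ex_nice by blast
  let ?w = "x(d := layer k x - 1)"
  have "?w(d := ?w d + 1) = x(d := layer k x)" by simp
  then have "level (x(d := layer k x)) = level ?w"
    using level_Suc(3)[OF v0 upd_d[OF x, of "layer k x - 1"]] bad by simp
  then show False using layer[OF x, of k] by simp
qed

lemma layer_inj:
  assumes x: "x \<in> lattice d" and eq: "layer k x = layer l x"
  shows "k = l"
proof -
  obtain v0 where v0: "nice v0" using ex_nice by blast
  let ?w = "x(d := layer k x - 1)"
  have "?w(d := ?w d + 1) = x(d := layer k x)" by simp
  then have "level (x(d := layer k x)) \<le> level ?w + 2"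
    using level_Suc(2)[OF v0 upd_d[OF x, of "layer k x - 1"]] by simp
  then show ?thesis using layer[OF x, of k] layer[OF x, of l] eq by simp
qed

lemma layer_lipschitz:
  assumes x: "x \<in> lattice d" and y: "y \<in> lattice d"
    and xy: "near d 1 (x(d := 0)) (y(d := 0))"
  shows "\<bar>layer k x - layer k y\<bar> \<le> 1"
proof -
  obtain v0 where v0: "nice v0" using ex_nice by blast
  have *: "layer k y \<le> layer k x + 1"
    if x: "x \<in> lattice d" and y: "y \<in> lattice d"
    and xy: "near d 1 (x(d := 0)) (y(d := 0))" for x y
  proof (rule ccontr)
    assume less: "\<not> layer k y \<le> layer k x + 1"
    have "near d (int 1) (x(d := layer k x)) (y(d := layer k x + 1))"
      unfolding near_def
    proof
      fix i assume "i \<in> {1..d}"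
      then have "\<bar>(x(d := 0)) i - (y(d := 0)) i\<bar> \<le> 1" using xy unfolding near_def by blast
      then show "\<bar>(x(d := layer k x)) i - (y(d := layer k x + 1)) i\<bar> \<le> int 1"
        by (cases "i = d") auto
    qed
    then have "level (x(d := layer k x)) \<le> level (y(d := layer k x + 1))"
      by (intro level_cone[OF v0 upd_d[OF x] upd_d[OF y], of 1]) auto
    also have "\<dots> \<le> level (y(d := layer k y - 1))"
      using less by (intro level_vertical_mono[OF y]) simp
    finally show False using layer(1)[OF x, of k] layer(2)[OF y, of k] by simp
  qed
  show ?thesis using *[OF x y xy] *[OF y x near_sym[OF xy]] by linarith
qed

text \<open>
  On the spine \<open>level\<close> equals the height at the point itself and at the one underneath. So there
  consecutive layers are exactly two apart, although elsewhere they may lie far from each other.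
\<close>
lemma layer_spine:
  assumes z: "z \<in> lattice d" and p: "p = z(1 := spine (z(d := 2 * k)))"
  shows "layer k p = 2 * k"
proof -
  define s where "s = z(d := 2 * k)"
  define v where "v = s(1 := spine s)"
  have s: "s \<in> lattice d" using z upd_d s_def by simp
  have pl: "p \<in> lattice d" using z upd_1 p by simp
  have ne: "1 \<noteq> d" using two_le_d by simp
  have v': "p(d := 2 * k) = v" unfolding p v_def s_def using ne by (simp add: fun_upd_twist)
  then have v'': "p(d := 2 * k - 1) = v(d := v d - 1)" using ne by (auto simp: p v_def s_def)
  have vd: "v d = 2 * k" using ne by (simp add: v_def s_def)
  show ?thesis
    by (rule layer_eq[OF pl])
      (use spine_nice[OF s v_def] level_nice[of v] level_nice[of "v(d := v d - 1)"] vd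
        in \<open>simp_all add: v' v''\<close>)
qed

lemma
  shows place_lattice: "z \<in> lattice d \<Longrightarrow> place z \<in> lattice d"
    and place_not_bad: "z \<in> lattice d \<Longrightarrow> place z \<notin> B"
    and place_inj: "inj_on place (lattice d)"
    and place_tooth: "z \<in> lattice d \<Longrightarrow> 1 \<le> i \<Longrightarrow> i \<le> d - 1 \<Longrightarrow>
          near d 1 (place z) (place (z(i := z i + 1)))"
    and place_spine: "z \<in> lattice d \<Longrightarrow> z 1 = 0 \<Longrightarrow> near d 2 (place z) (place (z(d := z d + 1)))"
proof -
  define s where "s z = spine (z(d := 2 * z d))" for z
  define q where "q z = z(1 := z 1 + s z)" for z :: "nat \<Rightarrow> int"
  have place: "place z = (q z)(d := layer (z d) (q z))" for z
    by (simp add: place_def q_def s_def Let_def)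
  have q: "q z \<in> lattice d" if "z \<in> lattice d" for z
    using that by (simp add: q_def upd_1[simplified])
  have ne: "1 \<noteq> d" using two_le_d by simp
  show "place z \<in> lattice d" if "z \<in> lattice d" for z
    unfolding place using upd_d q that by blast
  show "place z \<notin> B" if "z \<in> lattice d" for z
    unfolding place using layer_not_bad q that by blast
  show "inj_on place (lattice d)"
  proof (rule inj_onI)
    fix z w assume z: "z \<in> lattice d" and w: "w \<in> lattice d" and eq: "place z = place w"
    have mid: "z i = w i" if "i \<noteq> 1" "i \<noteq> d" for i
      using fun_cong[OF eq, of i] that by (simp add: place q_def)
    have one: "z 1 + s z = w 1 + s w"
      using fun_cong[OF eq, of 1] ne by (simp add: place q_def)
    define c where "c = (q z)(d := 0)"
    have c: "c \<in> lattice d" using q[OF z] upd_d c_def by simp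
    have cw: "c = (q w)(d := 0)" using mid one by (auto simp: c_def q_def)
    have lc: "layer k u = layer k (u(d := 0))" for k u by (simp add: layer_def)
    have "layer (z d) c = layer (w d) c"
      using fun_cong[OF eq, of d] lc[of "z d" "q z"] lc[of "w d" "q w"]
      by (simp add: place c_def[symmetric] cw[symmetric])
    then have dd: "z d = w d" using layer_inj[OF c] by blast
    have spine_1: "spine (u(1 := 0)) = spine u" for u by (simp add: spine_def)
    have "(z(d := 2 * z d))(1 := 0) = (w(d := 2 * w d))(1 := 0)"
      using mid dd by auto
    then have "s z = s w" unfolding s_def by (metis spine_1)
    then have "z 1 = w 1" using one by simp
    then show "z = w" using mid dd by (intro ext) metis
  qed
  have near_upd: "near d m (u(d := a)) (v(d := b))"
    if "near d m (u(d := 0)) (v(d := 0))" "\<bar>a - b\<bar> \<le> m" for m u v a b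
    using that unfolding near_def by (metis fun_upd_other fun_upd_same)
  show "near d 1 (place z) (place (z(i := z i + 1)))"
    if z: "z \<in> lattice d" and i: "1 \<le> i" "i \<le> d - 1" for z i
  proof -
    define w where "w = z(i := z i + 1)"
    have id: "i \<noteq> d" using i ne by auto
    have w: "w \<in> lattice d" unfolding w_def using i by (intro lattice_upd[OF z]) auto
    have wd: "w d = z d" using id by (simp add: w_def)
    have "\<bar>s z - s w\<bar> \<le> 1" unfolding s_def
      by (rule spine_lipschitz) (use z w upd_d id in \<open>auto simp: near_def w_def\<close>)
    moreover have "s z = s w" if "i = 1"
    proof -
      have "spine (u(1 := 0)) = spine u" for u by (simp add: spine_def)
      moreover have "(z(d := 2 * z d))(1 := 0) = (w(d := 2 * w d))(1 := 0)"
        using that ne unfolding w_def by auto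
      ultimately show ?thesis unfolding s_def by metis
    qed
    ultimately have n: "near d 1 ((q z)(d := 0)) ((q w)(d := 0))"
      using id ne by (auto simp: near_def q_def w_def)
    show ?thesis
      unfolding w_def[symmetric] place wd
      by (rule near_upd[OF n]) (rule layer_lipschitz[OF q[OF z] q[OF w] n])
  qed
  show "near d 2 (place z) (place (z(d := z d + 1)))"
    if z: "z \<in> lattice d" and z1: "z 1 = 0" for z
  proof -
    define w where "w = z(d := z d + 1)"
    have w: "w \<in> lattice d" unfolding w_def using upd_d z by blast
    have w1: "w 1 = 0" using ne z1 by (simp add: w_def)
    have top: "layer (u d) (q u) = 2 * u d" if "u \<in> lattice d" "u 1 = 0" for u
      by (rule layer_spine[OF that(1)]) (use that(2) in \<open>simp add: q_def s_def\<close>)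
    have "\<bar>s z - s w\<bar> \<le> 2" unfolding s_def
      by (rule spine_lipschitz) (use z w upd_d in \<open>auto simp: near_def w_def\<close>)
    then have n: "near d 2 ((q z)(d := 0)) ((q w)(d := 0))"
      using ne z1 by (auto simp: near_def q_def w_def)
    show ?thesis
      unfolding w_def[symmetric] place top[OF z z1] top[OF w w1]
      by (rule near_upd[OF n]) (simp add: w_def)
  qed
qed

end

section \<open>Dense walks are unlikely\<close>

lemma prob_all_closed:
  assumes p: "0 \<le> p" "p \<le> 1" and V: "finite V" "V \<subseteq> verts H"
  shows "measure (site_percolation H p) {\<omega> \<in> space (site_percolation H p). \<forall>v\<in>V. \<not> \<omega> v} = (1 - p) ^ card V"
proof -
  interpret product_prob_space "\<lambda>_. measure_pmf (bernoulli_pmf p)" "verts H" ..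
  have F: "measure (measure_pmf (bernoulli_pmf p)) {False} = 1 - p"
    using p by (simp add: measure_pmf_single)
  have "emeasure (site_percolation H p) {\<omega> \<in> space (site_percolation H p). \<forall>v\<in>V. \<omega> v \<in> {False}}
    = (\<Prod>v\<in>V. emeasure (measure_pmf (bernoulli_pmf p)) {False})"
    unfolding site_percolation_def using V by (intro emeasure_PiM_Collect) auto
  also have "\<dots> = ennreal ((1 - p) ^ card V)"
    using p by (simp add: measure_pmf.emeasure_eq_measure F ennreal_power)
  finally show ?thesis using p by (simp add: measure_def)
qed

lemma prob_space_site_percolation: "prob_space (site_percolation H p)"
  unfolding site_percolation_def by (intro prob_space_PiM) (rule measure_pmf.prob_space_axioms)

lemma pred_open [measurable]:
  "v \<in> verts H \<Longrightarrow> Measurable.pred (site_percolation H p) (\<lambda>\<omega>. \<omega> v)"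
  unfolding site_percolation_def
  by (rule measurable_compose[OF measurable_component_singleton]) auto

lemma verts_lattice_graph: "verts (lattice_graph d M) = lattice d"
  by (simp add: lattice_graph_def)

text \<open>
  Blocks are segments of \<open>L\<close> sites in direction \<open>1\<close>. A block is closed if all its sites are, which has
  probability \<open>(1 - p) ^ L\<close>; closed blocks become the bad points of the coarse lattice.
\<close>
definition site :: "nat \<Rightarrow> (nat \<Rightarrow> int) \<Rightarrow> nat \<Rightarrow> nat \<Rightarrow> int" where
  "site L b j = b(1 := int L * b 1 + int j)"

definition closed_blocks :: "nat \<Rightarrow> nat \<Rightarrow> ((nat \<Rightarrow> int) \<Rightarrow> bool) \<Rightarrow> (nat \<Rightarrow> int) set" where
  "closed_blocks d L \<omega> = {b \<in> lattice d. \<forall>j<L. \<not> \<omega> (site L b j)}"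

lemma site_lattice: "1 \<le> d \<Longrightarrow> b \<in> lattice d \<Longrightarrow> site L b j \<in> lattice d"
  unfolding site_def by (intro lattice_upd) auto

lemma site_inj:
  assumes "site L b j = site L b' j'" "j < L" "j' < L"
  shows "b = b' \<and> j = j'"
proof -
  have 1: "int L * b 1 + int j = int L * b' 1 + int j'"
    using fun_cong[OF assms(1), of 1] by (simp add: site_def)
  have "b 1 = (int L * b 1 + int j) div int L" "b' 1 = (int L * b' 1 + int j') div int L"
    using assms by simp_all
  then have "b 1 = b' 1" using 1 by simp
  moreover have "b i = b' i" if "i \<noteq> 1" for i
    using fun_cong[OF assms(1), of i] that by (simp add: site_def)
  ultimately have "b = b'" by (intro ext) metis
  then show ?thesis using 1 by simp
qed

lemma site_near:
  assumes bb: "near d 2 b b'" and j: "j < L" "j' < L"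
  shows "near d (int (3 * L)) (site L b j) (site L b' j')"
  unfolding near_def
proof
  fix i assume i: "i \<in> {1..d}"
  then have 2: "\<bar>b i - b' i\<bar> \<le> 2" using bb near_def by blast
  show "\<bar>site L b j i - site L b' j' i\<bar> \<le> int (3 * L)"
  proof (cases "i = 1")
    case True
    have "\<bar>int L * b 1 - int L * b' 1\<bar> = int L * \<bar>b 1 - b' 1\<bar>"
      by (simp add: abs_mult right_diff_distrib[symmetric])
    also have "\<dots> \<le> int L * 2" using 2 True by (intro mult_left_mono) auto
    finally show ?thesis using True j by (simp add: site_def)
  next
    case False
    then show ?thesis using 2 j by (simp add: site_def)
  qed
qed

definition dense_walk :: "nat \<Rightarrow> nat \<Rightarrow> (nat \<Rightarrow> int) \<Rightarrow> nat \<Rightarrow> ((nat \<Rightarrow> int) \<Rightarrow> bool) \<Rightarrow> bool" where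
  "dense_walk d L x R \<omega> \<longleftrightarrow> (\<exists>xs\<in>walks d (6 * R) x. R \<le> 4 * card (set xs \<inter> closed_blocks d L \<omega>))"

lemma dense_walk_alt:
  "dense_walk d L x R \<omega> \<longleftrightarrow> (\<exists>xs\<in>walks d (6 * R) x. \<exists>W\<in>{W. W \<subseteq> set xs \<and> R \<le> 4 * card W}. W \<subseteq> closed_blocks d L \<omega>)"
proof
  assume "dense_walk d L x R \<omega>"
  then obtain xs where "xs \<in> walks d (6 * R) x" "R \<le> 4 * card (set xs \<inter> closed_blocks d L \<omega>)"
    unfolding dense_walk_def by blast
  then show "\<exists>xs\<in>walks d (6 * R) x. \<exists>W\<in>{W. W \<subseteq> set xs \<and> R \<le> 4 * card W}. W \<subseteq> closed_blocks d L \<omega>"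
    by (intro bexI[of _ xs] bexI[of _ "set xs \<inter> closed_blocks d L \<omega>"]) auto
next
  assume "\<exists>xs\<in>walks d (6 * R) x. \<exists>W\<in>{W. W \<subseteq> set xs \<and> R \<le> 4 * card W}. W \<subseteq> closed_blocks d L \<omega>"
  then obtain xs W where w: "xs \<in> walks d (6 * R) x" "W \<subseteq> set xs" "R \<le> 4 * card W" "W \<subseteq> closed_blocks d L \<omega>"
    by blast
  then have "card W \<le> card (set xs \<inter> closed_blocks d L \<omega>)" by (intro card_mono) auto
  then show "dense_walk d L x R \<omega>" unfolding dense_walk_def using w by (intro bexI[of _ xs]) auto
qed

definition column :: "nat \<Rightarrow> nat \<Rightarrow> nat \<Rightarrow> int" where
  "column d = from_nat_into (lattice d)"

lemma countable_lattice: "countable (lattice d)"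
  unfolding lattice_def by (intro countable_PiE) auto

lemma range_column: "range (column d) = lattice d"
proof -
  have "(\<lambda>i\<in>{1..d}. 0) \<in> lattice d" by (auto simp: lattice_def)
  then show ?thesis unfolding column_def
    using range_from_nat_into[OF _ countable_lattice] by blast
qed

context
  fixes d M :: nat and p :: real
  assumes d: "2 \<le> d" and p: "0 \<le> p" "p \<le> 1"
begin

abbreviation \<mu> where "\<mu> \<equiv> site_percolation (lattice_graph d M) p"

interpretation prob_space \<mu> by (rule prob_space_site_percolation)

lemma pred_closed_block [measurable]: "Measurable.pred \<mu> (\<lambda>\<omega>. b \<in> closed_blocks d L \<omega>)"
proof (cases "b \<in> lattice d")
  case True
  then have [measurable]: "Measurable.pred \<mu> (\<lambda>\<omega>. \<omega> (site L b j))" for j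
    using d by (intro pred_open) (simp add: verts_lattice_graph site_lattice)
  show ?thesis using True unfolding closed_blocks_def by simp
qed (simp add: closed_blocks_def)

lemma prob_closed_blocks:
  assumes W: "finite W" "W \<subseteq> lattice d"
  shows "prob {\<omega> \<in> space \<mu>. W \<subseteq> closed_blocks d L \<omega>} = ((1 - p) ^ L) ^ card W"
proof -
  let ?V = "(\<lambda>(b, j). site L b j) ` (W \<times> {..<L})"
  have "{\<omega> \<in> space \<mu>. W \<subseteq> closed_blocks d L \<omega>} = {\<omega> \<in> space \<mu>. \<forall>v\<in>?V. \<not> \<omega> v}"
    using W by (auto simp: closed_blocks_def)
  moreover have "prob {\<omega> \<in> space \<mu>. \<forall>v\<in>?V. \<not> \<omega> v} = (1 - p) ^ card ?V"
    by (rule prob_all_closed[OF p]) (use W d in \<open>auto simp: verts_lattice_graph intro: site_lattice\<close>)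
  moreover have "card ?V = card W * L"
    by (subst card_image) (auto simp: inj_on_def card_cartesian_product dest: site_inj)
  ultimately show ?thesis by (simp add: power_mult[symmetric] mult.commute)
qed

lemma events_closed_blocks:
  assumes "finite W"
  shows "{\<omega> \<in> space \<mu>. W \<subseteq> closed_blocks d L \<omega>} \<in> events"
proof -
  have "Measurable.pred \<mu> (\<lambda>\<omega>. \<forall>b\<in>W. b \<in> closed_blocks d L \<omega>)"
    using assms by measurable
  then show ?thesis unfolding subset_eq by simp
qed

lemma events_dense_walk: "{\<omega> \<in> space \<mu>. dense_walk d L x R \<omega>} \<in> events"
proof -
  have "{\<omega> \<in> space \<mu>. dense_walk d L x R \<omega>} =
    (\<Union>xs\<in>walks d (6 * R) x. \<Union>W\<in>{W. W \<subseteq> set xs \<and> R \<le> 4 * card W}.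
       {\<omega> \<in> space \<mu>. W \<subseteq> closed_blocks d L \<omega>})"
    unfolding dense_walk_alt by blast
  moreover have "finite {W. W \<subseteq> set xs \<and> R \<le> 4 * card W}" for xs :: "(nat \<Rightarrow> int) list"
    by (rule finite_subset[of _ "Pow (set xs)"]) auto
  ultimately show ?thesis
    using card_walks[of d "6 * R" x]
    by (auto intro!: sets.finite_UN events_closed_blocks intro: finite_subset)
qed

text \<open>
  A union bound over the walks, at most \<open>3 ^ d\<close> for each step, and over the sets of at least \<open>R / 4\<close>
  closed blocks on a walk of \<open>6 * R + 1 \<le> 7 * R\<close> points. The fourth power turns \<open>R / 4\<close> blocks into
  the exponent \<open>R\<close>.
\<close>
lemma prob_dense_walk:
  assumes \<eta>: "(1 - p) ^ L \<le> \<eta> ^ 4" "0 \<le> \<eta>" "\<eta> \<le> 1" and R: "1 \<le> R"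
  shows "prob {\<omega> \<in> space \<mu>. dense_walk d L x R \<omega>} \<le> ((3 ^ d) ^ 6 * 2 ^ 7 * \<eta>) ^ R"
proof -
  define \<W> where "\<W> xs = {W. W \<subseteq> set xs \<and> R \<le> 4 * card W}" for xs :: "(nat \<Rightarrow> int) list"
  define E where "E W = {\<omega> \<in> space \<mu>. W \<subseteq> closed_blocks d L \<omega>}" for W
  have fW: "finite (\<W> xs)" for xs
    by (rule finite_subset[of _ "Pow (set xs)"]) (auto simp: \<W>_def)
  have cW: "card (\<W> xs) \<le> 2 ^ (7 * R)" if "xs \<in> walks d (6 * R) x" for xs
  proof -
    have "card (\<W> xs) \<le> card (Pow (set xs))" by (rule card_mono) (auto simp: \<W>_def)
    also have "\<dots> = 2 ^ card (set xs)" by (simp add: card_Pow)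
    also have "\<dots> \<le> 2 ^ (7 * R)"
      using card_length[of xs] that R by (intro power_increasing) (auto simp: walks_def)
    finally show ?thesis .
  qed
  have EM: "E W \<in> events" if "W \<in> \<W> xs" for W xs
  proof -
    have "finite W" using that finite_subset unfolding \<W>_def by blast
    then show ?thesis unfolding E_def by (rule events_closed_blocks)
  qed
  have PE: "prob (E W) \<le> \<eta> ^ R" if "xs \<in> walks d (6 * R) x" "W \<in> \<W> xs" for xs W
  proof -
    have W: "finite W" "W \<subseteq> lattice d" "R \<le> 4 * card W"
      using that by (auto simp: \<W>_def walks_def intro: finite_subset)
    have "prob (E W) = ((1 - p) ^ L) ^ card W"
      unfolding E_def by (rule prob_closed_blocks[OF W(1,2)])
    also have "\<dots> \<le> (\<eta> ^ 4) ^ card W" using \<eta> p by (intro power_mono) auto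
    also have "\<dots> = \<eta> ^ (4 * card W)" by (simp add: power_mult)
    also have "\<dots> \<le> \<eta> ^ R" using \<eta> W(3) by (intro power_decreasing) auto
    finally show ?thesis .
  qed
  have eq: "{\<omega> \<in> space \<mu>. dense_walk d L x R \<omega>} = (\<Union>xs\<in>walks d (6 * R) x. \<Union>W\<in>\<W> xs. E W)"
    unfolding dense_walk_alt \<W>_def E_def by blast
  have one: "prob (\<Union>W\<in>\<W> xs. E W) \<le> 2 ^ (7 * R) * \<eta> ^ R" if xs: "xs \<in> walks d (6 * R) x" for xs
  proof -
    have "prob (\<Union>W\<in>\<W> xs. E W) \<le> (\<Sum>W\<in>\<W> xs. prob (E W))"
      using fW EM by (intro measure_UNION_le) auto
    also have "\<dots> \<le> (\<Sum>W\<in>\<W> xs. \<eta> ^ R)" using PE xs by (intro sum_mono) auto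
    also have "\<dots> = real (card (\<W> xs)) * \<eta> ^ R" by simp
    also have "\<dots> \<le> 2 ^ (7 * R) * \<eta> ^ R"
    proof (intro mult_right_mono)
      have "real (card (\<W> xs)) \<le> real (2 ^ (7 * R))" using cW[OF xs] of_nat_le_iff by blast
      then show "real (card (\<W> xs)) \<le> 2 ^ (7 * R)" by simp
    qed (use \<eta> in auto)
    finally show ?thesis .
  qed
  have "prob {\<omega> \<in> space \<mu>. dense_walk d L x R \<omega>} \<le> (\<Sum>xs\<in>walks d (6 * R) x. prob (\<Union>W\<in>\<W> xs. E W))"
    unfolding eq using card_walks fW EM by (intro measure_UNION_le sets.finite_UN) auto
  also have "\<dots> \<le> (\<Sum>xs\<in>walks d (6 * R) x. 2 ^ (7 * R) * \<eta> ^ R)" using one by (intro sum_mono) auto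
  also have "\<dots> = real (card (walks d (6 * R) x)) * (2 ^ (7 * R) * \<eta> ^ R)" by simp
  also have "\<dots> \<le> (3 ^ d) ^ (6 * R) * (2 ^ (7 * R) * \<eta> ^ R)"
  proof (intro mult_right_mono)
    have "real (card (walks d (6 * R) x)) \<le> real ((3 ^ d) ^ (6 * R))"
      using card_walks of_nat_le_iff by blast
    then show "real (card (walks d (6 * R) x)) \<le> (3 ^ d) ^ (6 * R)" by simp
  qed (use \<eta> in auto)
  also have "\<dots> = ((3 ^ d) ^ 6 * 2 ^ 7 * \<eta>) ^ R"
    by (simp only: power_mult power_mult_distrib mult.assoc)
  finally show ?thesis .
qed

text \<open>
  Giving the \<open>i\<close>-th column the threshold height \<open>6 * (1 + i)\<close> makes the failure probabilities of the
  columns summable. With ratio \<open>1 / 4\<close> the total is at most \<open>4 / 9\<close>, so all columns succeed together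
  with positive probability.
\<close>
lemma no_dense_walk_positive:
  assumes L: "(1 - p) ^ L \<le> (1 / (4 * ((3 ^ d) ^ 6 * 2 ^ 7))) ^ 4"
  shows "0 < prob {\<omega> \<in> space \<mu>. \<forall>i. \<forall>R\<ge>Suc i. \<not> dense_walk d L ((column d i)(1 := 6 * (1 + int i))) R \<omega>}"
proof -
  define c :: real where "c = (3 ^ d) ^ 6 * 2 ^ 7"
  have c: "1 \<le> c" unfolding c_def by (intro mult_ge1_I one_le_power) auto
  have L': "(1 - p) ^ L \<le> (1 / (4 * c)) ^ 4" using L unfolding c_def .
  have quarter: "c * (1 / (4 * c)) = 1 / 4" using c by (simp add: field_simps)
  have small: "0 \<le> 1 / (4 * c)" "1 / (4 * c) \<le> 1" using c by (simp_all add: divide_le_eq_1)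
  define E where "E i m = {\<omega> \<in> space \<mu>. dense_walk d L ((column d i)(1 := 6 * (1 + int i))) (Suc (i + m)) \<omega>}" for i m
  have EM [measurable]: "E i m \<in> events" for i m unfolding E_def by (rule events_dense_walk)
  have PE: "prob (E i m) \<le> (1 / 4) ^ Suc i * (1 / 4) ^ m" for i m
  proof -
    have "prob (E i m) \<le> (c * (1 / (4 * c))) ^ Suc (i + m)"
      unfolding E_def c_def[symmetric] by (subst c_def) (rule prob_dense_walk[OF L' small], simp)
    also have "\<dots> = (1 / 4) ^ (Suc i + m)" by (simp only: quarter add_Suc)
    finally show ?thesis by (simp only: power_add)
  qed
  have geo: "summable (\<lambda>m. (1 / 4 :: real) ^ m)" "(\<Sum>m. (1 / 4 :: real) ^ m) = 4 / 3"
    by (auto simp: suminf_geometric)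
  have Pi: "prob (\<Union>m. E i m) \<le> 1 / 3 * (1 / 4) ^ i" for i
  proof -
    have s: "summable (\<lambda>m. (1 / 4) ^ Suc i * (1 / 4 :: real) ^ m)" using geo by (intro summable_mult)
    then have s': "summable (\<lambda>m. prob (E i m))"
      using PE by (intro summable_comparison_test[OF _ s]) auto
    have "prob (\<Union>m. E i m) \<le> (\<Sum>m. prob (E i m))"
      using EM s' by (intro finite_measure_subadditive_countably) auto
    also have "\<dots> \<le> (\<Sum>m. (1 / 4) ^ Suc i * (1 / 4) ^ m)" using PE s s' by (intro suminf_le)
    also have "\<dots> = (1 / 4) ^ Suc i * (4 / 3)" using geo by (subst suminf_mult) auto
    finally show ?thesis by simp
  qed
  have s: "summable (\<lambda>i. 1 / 3 * (1 / 4 :: real) ^ i)" using geo by (intro summable_mult)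
  then have s': "summable (\<lambda>i. prob (\<Union>m. E i m))"
    using Pi by (intro summable_comparison_test[OF _ s]) auto
  have "prob (\<Union>i. \<Union>m. E i m) \<le> (\<Sum>i. prob (\<Union>m. E i m))"
    using EM s' by (intro finite_measure_subadditive_countably) auto
  also have "\<dots> \<le> (\<Sum>i. 1 / 3 * (1 / 4) ^ i)" using Pi s s' by (intro suminf_le)
  also have "\<dots> = 4 / 9" using geo by (subst suminf_mult) auto
  finally have lt: "prob (\<Union>i. \<Union>m. E i m) < 1" by simp
  have eq: "{\<omega> \<in> space \<mu>. \<forall>i. \<forall>R\<ge>Suc i. \<not> dense_walk d L ((column d i)(1 := 6 * (1 + int i))) R \<omega>}
      = space \<mu> - (\<Union>i. \<Union>m. E i m)"
    unfolding E_def by (auto simp: le_iff_add)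
  show ?thesis unfolding eq using lt EM by (subst prob_compl) auto
qed

end

section \<open>Measurability of the embedding event\<close>

text \<open>
  Tychonoff's theorem for a product of finite discrete spaces: each constraint defines a closed set.
\<close>
lemma pairwise_choice_compactness:
  assumes fin: "\<And>x. x \<in> I \<Longrightarrow> finite (A x)"
    and ex: "\<And>X. finite X \<Longrightarrow> X \<subseteq> I \<Longrightarrow>
      \<exists>f. (\<forall>x\<in>X. f x \<in> A x) \<and> (\<forall>x\<in>X. \<forall>y\<in>X. c x y (f x) (f y))"
  shows "\<exists>f. (\<forall>x\<in>I. f x \<in> A x) \<and> (\<forall>x\<in>I. \<forall>y\<in>I. c x y (f x) (f y))"
proof -
  define T where "T = product_topology (\<lambda>x. discrete_topology (A x)) I"
  have T: "topspace T = (\<Pi>\<^sub>E x\<in>I. A x)" by (simp add: T_def)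
  have "compact_space T"
    unfolding T_def compact_space_product_topology by (simp add: compact_space_discrete_topology fin)
  define K where "K = (\<lambda>(x, y). {f \<in> topspace T. c x y (f x) (f y)})"
  have closed: "closedin T (K (x, y))" if "x \<in> I" "y \<in> I" for x y
  proof -
    have fib: "closedin T {f \<in> topspace T. f z \<in> {a}}" if "z \<in> I" "a \<in> A z" for z a
    proof (rule closedin_continuous_map_preimage)
      show "continuous_map T (discrete_topology (A z)) (\<lambda>f. f z)"
        unfolding T_def using continuous_map_product_projection[OF that(1)] .
      show "closedin (discrete_topology (A z)) {a}" using that by simp
    qed
    have "closedin T (\<Union>(a, b)\<in>{(a, b) \<in> A x \<times> A y. c x y a b}.
        {f \<in> topspace T. f x \<in> {a}} \<inter> {f \<in> topspace T. f y \<in> {b}})"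
    proof (rule closedin_Union)
      have "finite (A x \<times> A y)" using fin that by blast
      then show "finite ((\<lambda>(a, b). {f \<in> topspace T. f x \<in> {a}} \<inter> {f \<in> topspace T. f y \<in> {b}})
          ` {(a, b) \<in> A x \<times> A y. c x y a b})"
        by (intro finite_imageI) (auto intro: finite_subset[rotated])
    qed (use fib that in \<open>auto simp del: singleton_iff intro!: closedin_Int\<close>)
    also have "(\<Union>(a, b)\<in>{(a, b) \<in> A x \<times> A y. c x y a b}.
        {f \<in> topspace T. f x \<in> {a}} \<inter> {f \<in> topspace T. f y \<in> {b}}) = K (x, y)"
      using that by (auto simp: K_def T)
    finally show ?thesis .
  qed
  have "\<Inter>(insert (topspace T) (K ` (I \<times> I))) \<noteq> {}"
  proof (rule \<open>compact_space T\<close>[unfolded compact_space_fip, rule_format], intro conjI ballI allI impI)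
    fix C assume "C \<in> insert (topspace T) (K ` (I \<times> I))"
    then show "closedin T C" using closed by auto
  next
    fix \<F> assume F: "finite \<F> \<and> \<F> \<subseteq> insert (topspace T) (K ` (I \<times> I))"
    then have "finite (\<F> - {topspace T})" "\<F> - {topspace T} \<subseteq> K ` (I \<times> I)" by auto
    then obtain P where P: "P \<subseteq> I \<times> I" "finite P" "\<F> - {topspace T} = K ` P"
      by (meson finite_subset_image)
    define X where "X = fst ` P \<union> snd ` P"
    have X: "finite X" "X \<subseteq> I" using P by (auto simp: X_def)
    obtain f where f: "\<forall>x\<in>X. f x \<in> A x" "\<forall>x\<in>X. \<forall>y\<in>X. c x y (f x) (f y)"
      using ex[OF X] by blast
    have "A x \<noteq> {}" if "x \<in> I" for x using ex[of "{x}"] that by auto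
    then have some: "(SOME a. a \<in> A x) \<in> A x" if "x \<in> I" for x
      using that some_in_eq by blast
    define g where "g = (\<lambda>x\<in>I. if x \<in> X then f x else SOME a. a \<in> A x)"
    have g: "g \<in> topspace T" unfolding T g_def using f(1) some by auto
    have gX: "g x = f x" if "x \<in> X" for x using that X by (auto simp: g_def)
    have "g \<in> K q" if "q \<in> P" for q
    proof -
      have "fst q \<in> X" "snd q \<in> X" using that by (auto simp: X_def)
      then have "c (fst q) (snd q) (g (fst q)) (g (snd q))" using f(2) gX by simp
      then show ?thesis using g by (auto simp: K_def split: prod.split)
    qed
    then have "g \<in> \<Inter>\<F>" using g P(3) by blast
    then show "\<Inter>\<F> \<noteq> {}" by blast
  qed
  then obtain f where f: "f \<in> topspace T" "\<And>x y. x \<in> I \<Longrightarrow> y \<in> I \<Longrightarrow> f \<in> K (x, y)" by blast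
  then show ?thesis by (intro exI[of _ f]) (auto simp: T K_def)
qed

lemma pred_countable_Bex:
  assumes "countable X" "\<And>i. i \<in> X \<Longrightarrow> Measurable.pred M (\<lambda>x. P x i)"
  shows "Measurable.pred M (\<lambda>x. \<exists>i\<in>X. P x i)"
proof -
  have "{x \<in> space M. \<exists>i\<in>X. P x i} = (\<Union>i\<in>X. {x \<in> space M. P x i})" by blast
  then show ?thesis using assms unfolding pred_def by (auto intro!: sets.countable_UN'')
qed

lemma pred_countable_Ball:
  assumes "countable X" "\<And>i. i \<in> X \<Longrightarrow> Measurable.pred M (\<lambda>x. P x i)"
  shows "Measurable.pred M (\<lambda>x. \<forall>i\<in>X. P x i)"
proof -
  have "Measurable.pred M (\<lambda>x. \<not> (\<exists>i\<in>X. \<not> P x i))"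
    by (intro pred_intros_logic pred_countable_Bex assms)
  then show ?thesis by simp
qed

text \<open>
  The existence of an embedding is an uncountable union over maps. If the images of all vertices are
  confined to finite sets once the position \<open>v\<close> of one of them is known, compactness replaces it by
  the existence, for some \<open>v\<close> and every finite set of vertices, of a partial embedding; this
  involves only countably many events.
\<close>
lemma embedding_event:
  fixes G :: "'a graph" and H :: "'b graph"
  assumes G: "countable (verts G)" and H: "countable (verts H)"
    and fin: "\<And>v x. finite (A v x)"
    and bound: "\<And>f U. U \<subseteq> verts H \<Longrightarrow> embedding_into G H U f \<Longrightarrow> \<exists>v\<in>verts H. \<forall>x\<in>verts G. f x \<in> A v x"
  shows "{\<omega> \<in> space (site_percolation H p). \<exists>f. embedding_into G H (open_set H \<omega>) f}
     \<in> sets (site_percolation H p)"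
proof -
  define c where "c x y a b \<longleftrightarrow> (x \<noteq> y \<longrightarrow> a \<noteq> b) \<and> ({x, y} \<in> edges G \<longrightarrow> {a, b} \<in> edges H)"
    for x y :: 'a and a b :: 'b
  define \<X> where "\<X> = {X. finite X \<and> X \<subseteq> verts G}"
  define F where "F v X = {f \<in> (\<Pi>\<^sub>E x\<in>X. A v x \<inter> verts H). \<forall>x\<in>X. \<forall>y\<in>X. c x y (f x) (f y)}" for v X
  have iff: "(\<exists>f. embedding_into G H (open_set H \<omega>) f) \<longleftrightarrow>
    (\<exists>v\<in>verts H. \<forall>X\<in>\<X>. \<exists>f\<in>F v X. \<forall>x\<in>X. \<omega> (f x))" for \<omega>
  proof
    assume "\<exists>f. embedding_into G H (open_set H \<omega>) f"
    then obtain f where f: "embedding_into G H (open_set H \<omega>) f" by blast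
    then obtain v where v: "v \<in> verts H" "\<forall>x\<in>verts G. f x \<in> A v x"
      using bound[of "open_set H \<omega>" f] unfolding open_set_def by blast
    have "restrict f X \<in> F v X \<and> (\<forall>x\<in>X. \<omega> (restrict f X x))" if "X \<in> \<X>" for X
    proof -
      have X: "X \<subseteq> verts G" using that \<X>_def by blast
      have "c x y (f x) (f y)" if "x \<in> X" "y \<in> X" for x y
        using f X that unfolding embedding_into_def c_def inj_on_def by blast
      moreover have "f x \<in> A v x \<inter> verts H \<and> \<omega> (f x)" if "x \<in> X" for x
        using f X v that unfolding embedding_into_def open_set_def by blast
      ultimately show ?thesis unfolding F_def by simp
    qed
    then show "\<exists>v\<in>verts H. \<forall>X\<in>\<X>. \<exists>f\<in>F v X. \<forall>x\<in>X. \<omega> (f x)" using v by blast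
  next
    assume "\<exists>v\<in>verts H. \<forall>X\<in>\<X>. \<exists>f\<in>F v X. \<forall>x\<in>X. \<omega> (f x)"
    then obtain v where v: "\<forall>X\<in>\<X>. \<exists>f\<in>F v X. \<forall>x\<in>X. \<omega> (f x)" by blast
    have "\<exists>f. (\<forall>x\<in>verts G. f x \<in> A v x \<inter> open_set H \<omega>) \<and> (\<forall>x\<in>verts G. \<forall>y\<in>verts G. c x y (f x) (f y))"
    proof (rule pairwise_choice_compactness)
      fix X assume "finite X" "X \<subseteq> verts G"
      then obtain f where f: "f \<in> F v X" "\<forall>x\<in>X. \<omega> (f x)" using v \<X>_def by blast
      have "f x \<in> A v x \<inter> open_set H \<omega>" if "x \<in> X" for x
        using f that unfolding F_def open_set_def by auto
      moreover have "\<forall>x\<in>X. \<forall>y\<in>X. c x y (f x) (f y)" using f(1) unfolding F_def by blast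
      ultimately show "\<exists>f. (\<forall>x\<in>X. f x \<in> A v x \<inter> open_set H \<omega>) \<and> (\<forall>x\<in>X. \<forall>y\<in>X. c x y (f x) (f y))"
        by blast
    qed (simp add: fin)
    then obtain f where f: "\<And>x. x \<in> verts G \<Longrightarrow> f x \<in> open_set H \<omega>"
      "\<And>x y. x \<in> verts G \<Longrightarrow> y \<in> verts G \<Longrightarrow> c x y (f x) (f y)" by blast
    have "inj_on f (verts G)" using f(2) unfolding c_def inj_on_def by blast
    then have "embedding_into G H (open_set H \<omega>) f"
      unfolding embedding_into_def using f unfolding c_def by blast
    then show "\<exists>f. embedding_into G H (open_set H \<omega>) f" by blast
  qed
  have "countable \<X>" unfolding \<X>_def by (rule countable_Collect_finite_subset[OF G])
  moreover have "Measurable.pred (site_percolation H p) (\<lambda>\<omega>. \<exists>f\<in>F v X. \<forall>x\<in>X. \<omega> (f x))"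
    if "X \<in> \<X>" for v X
  proof -
    have X: "finite X" using that \<X>_def by blast
    have "finite (\<Pi>\<^sub>E x\<in>X. A v x \<inter> verts H)" using X fin by (intro finite_PiE) auto
    then have FX: "finite (F v X)" unfolding F_def by (rule finite_subset[rotated]) blast
    have "f x \<in> verts H" if "f \<in> F v X" "x \<in> X" for f x using that unfolding F_def by auto
    then show ?thesis
      by (intro pred_countable_Bex pred_countable_Ball countable_finite X FX pred_open)
  qed
  ultimately have "Measurable.pred (site_percolation H p)
      (\<lambda>\<omega>. \<exists>v\<in>verts H. \<forall>X\<in>\<X>. \<exists>f\<in>F v X. \<forall>x\<in>X. \<omega> (f x))"
    by (intro pred_countable_Bex[OF H] pred_countable_Ball)
  then show ?thesis unfolding iff by simp
qed

lemma sup_dist_le_iff: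
  assumes "1 \<le> d"
  shows "sup_dist d x y \<le> m \<longleftrightarrow> near d m x y"
  unfolding sup_dist_def near_def using assms by (subst Max_le_iff) auto

lemma sup_dist_pos:
  assumes "x \<in> lattice d" "y \<in> lattice d" "x \<noteq> y"
  shows "0 < sup_dist d x y"
proof -
  obtain i where i: "i \<in> {1..d}" "x i \<noteq> y i" using assms lattice_eqI by blast
  then have "0 < \<bar>x i - y i\<bar>" by simp
  also have "\<dots> \<le> sup_dist d x y" unfolding sup_dist_def using i by (intro Max_ge) auto
  finally show ?thesis .
qed

lemma lattice_edgeI:
  assumes "1 \<le> d" "x \<in> lattice d" "y \<in> lattice d" "x \<noteq> y" "near d (int M) x y"
  shows "{x, y} \<in> edges (lattice_graph d M)"
proof -
  have "0 < sup_dist d x y" "sup_dist d x y \<le> int M"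
    using assms sup_dist_pos sup_dist_le_iff by blast+
  then show ?thesis using assms(2,3) unfolding lattice_graph_def by auto
qed

lemma lattice_edgeD:
  assumes "1 \<le> d" "{x, y} \<in> edges (lattice_graph d M)"
  shows "near d (int M) x y"
proof -
  obtain u v where uv: "{x, y} = {u, v}" "sup_dist d u v \<le> int M"
    using assms(2) unfolding lattice_graph_def by auto
  then have "near d (int M) u v" using sup_dist_le_iff[OF assms(1)] by blast
  then show ?thesis using uv(1) near_sym by (auto simp: doubleton_eq_iff)
qed

lemma verts_comb: "verts (comb_graph d) = lattice d"
  by (simp add: comb_graph_def)

lemma comb_edge_cases:
  assumes "{x, y} \<in> edges (comb_graph d)"
  obtains z i where "z \<in> lattice d" "1 \<le> i" "i \<le> d - 1" "{x, y} = {z, z(i := z i + 1)}"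
  | z where "z \<in> lattice d" "z 1 = 0" "{x, y} = {z, z(d := z d + 1)}"
  using assms unfolding comb_graph_def by auto

text \<open>
  The comb is connected: the coordinates other than \<open>d\<close> are brought to zero first, after which the
  point is on the spine.
\<close>
lemma comb_edge_towards_origin:
  assumes d: "2 \<le> d" and x: "x \<in> lattice d" and nz: "\<exists>i\<in>{1..d}. x i \<noteq> 0"
  shows "\<exists>i\<in>{1..d}. x i \<noteq> 0 \<and> {x(i := x i - sgn (x i)), x} \<in> edges (comb_graph d)"
proof -
  have up: "\<exists>z. z \<in> lattice d \<and> (1 \<noteq> i \<longrightarrow> z 1 = x 1) \<and> {x(i := x i - sgn (x i)), x} = {z, z(i := z i + 1)}"
    if i: "i \<in> {1..d}" "x i \<noteq> 0" for i
  proof (cases "0 < x i")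
    case True
    then show ?thesis using lattice_upd[OF x i(1)]
      by (intro exI[of _ "x(i := x i - 1)"]) auto
  next
    case False
    then have "sgn (x i) = -1" using i by simp
    then show ?thesis using x by (intro exI[of _ x]) auto
  qed
  show ?thesis
  proof (cases "\<exists>i\<in>{1..d - 1}. x i \<noteq> 0")
    case True
    then obtain i where i: "i \<in> {1..d - 1}" "x i \<noteq> 0" by blast
    then have "i \<in> {1..d}" by auto
    moreover from up[OF this i(2)] obtain z where
      z: "z \<in> lattice d" "{x(i := x i - sgn (x i)), x} = {z, z(i := z i + 1)}" by blast
    have "{x(i := x i - sgn (x i)), x} \<in> edges (comb_graph d)"
      unfolding z(2) comb_graph_def using z(1) i(1) by auto
    ultimately show ?thesis using i(2) by blast
  next
    case False
    have "i = d" if "i \<in> {1..d}" "x i \<noteq> 0" for i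
    proof (rule ccontr)
      assume "i \<noteq> d"
      then have "i \<in> {1..d - 1}" using that by auto
      then show False using that False by blast
    qed
    then have "x d \<noteq> 0" using nz by metis
    moreover have "x 1 = 0" using False d by force
    ultimately have xd: "x d \<noteq> 0" "x 1 = 0" by blast+
    moreover have dd: "d \<in> {1..d}" "1 \<noteq> d" using d by auto
    moreover obtain z where "z \<in> lattice d" "z 1 = x 1" "{x(d := x d - sgn (x d)), x} = {z, z(d := z d + 1)}"
      using up[of d] xd(1) dd by blast
    ultimately have "{x(d := x d - sgn (x d)), x} \<in> edges (comb_graph d)" unfolding comb_graph_def by auto
    then show ?thesis using xd dd by blast
  qed
qed

lemma comb_embedding_bounded:
  assumes d: "2 \<le> d" and x: "x \<in> lattice d"
  shows "\<exists>n::nat. \<forall>U f. embedding_into (comb_graph d) (lattice_graph d M) U f \<longrightarrow>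
    near d (int n) (f (\<lambda>i\<in>{1..d}. 0)) (f x)"
  using x
proof (induction "nat (\<Sum>i\<in>{1..d}. \<bar>x i\<bar>)" arbitrary: x rule: less_induct)
  case less
  show ?case
  proof (cases "\<exists>i\<in>{1..d}. x i \<noteq> 0")
    case False
    then have "x = (\<lambda>i\<in>{1..d}. 0)"
      using less.prems by (intro lattice_eqI[of x d]) (auto simp: lattice_def)
    then show ?thesis by (intro exI[of _ 0]) (simp add: near_refl)
  next
    case True
    then obtain i where i: "i \<in> {1..d}" "x i \<noteq> 0"
      and e: "{x(i := x i - sgn (x i)), x} \<in> edges (comb_graph d)"
      using comb_edge_towards_origin[OF d less.prems] by blast
    define y where "y = x(i := x i - sgn (x i))"
    have y: "y \<in> lattice d" unfolding y_def by (rule lattice_upd[OF less.prems i(1)])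
    have "(\<Sum>j\<in>{1..d}. \<bar>y j\<bar>) < (\<Sum>j\<in>{1..d}. \<bar>x j\<bar>)"
    proof (rule sum_strict_mono_ex1)
      show "\<exists>a\<in>{1..d}. \<bar>y a\<bar> < \<bar>x a\<bar>"
        using i by (intro bexI[of _ i]) (auto simp: y_def sgn_if)
    qed (auto simp: y_def sgn_if)
    moreover have "0 \<le> (\<Sum>j\<in>{1..d}. \<bar>y j\<bar>)" by (simp add: sum_nonneg)
    ultimately have "nat (\<Sum>j\<in>{1..d}. \<bar>y j\<bar>) < nat (\<Sum>j\<in>{1..d}. \<bar>x j\<bar>)" by linarith
    then obtain n where n: "near d (int n) (f (\<lambda>i\<in>{1..d}. 0)) (f y)"
      if "embedding_into (comb_graph d) (lattice_graph d M) U f" for U f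
      using less.hyps[of y] y by blast
    have "near d (int (n + M)) (f (\<lambda>i\<in>{1..d}. 0)) (f x)"
      if f: "embedding_into (comb_graph d) (lattice_graph d M) U f" for U f
    proof -
      have "{f y, f x} \<in> edges (lattice_graph d M)"
        using f y less.prems e unfolding embedding_into_def y_def[symmetric] verts_comb by blast
      then have "near d (int M) (f y) (f x)" using lattice_edgeD d by simp
      then show ?thesis using near_trans[OF n[OF f]] by simp
    qed
    then show ?thesis by blast
  qed
qed

lemma comb_embedding_event:
  assumes d: "2 \<le> d"
  shows "{\<omega> \<in> space (site_percolation (lattice_graph d M) p).
      \<exists>f. embedding_into (comb_graph d) (lattice_graph d M) (open_set (lattice_graph d M) \<omega>) f}
    \<in> sets (site_percolation (lattice_graph d M) p)"
proof -
  define r where "r x = (SOME n. \<forall>U f. embedding_into (comb_graph d) (lattice_graph d M) U f \<longrightarrow>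
    near d (int n) (f (\<lambda>i\<in>{1..d}. 0)) (f x))" for x
  have r: "near d (int (r x)) (f (\<lambda>i\<in>{1..d}. 0)) (f x)"
    if "x \<in> lattice d" "embedding_into (comb_graph d) (lattice_graph d M) U f" for x U f
    using someI_ex[OF comb_embedding_bounded[OF d that(1), of M]] that(2) unfolding r_def by blast
  define A where "A v x = {w \<in> lattice d. near d (int (r x)) v w}" for v x
  note vG = verts_comb and vH = verts_lattice_graph
  show ?thesis
  proof (rule embedding_event[where A = A])
    fix v x
    show "finite (A v x)" unfolding A_def lattice_cube_eq_PiE by (intro finite_PiE) auto
  next
    fix f and U :: "(nat \<Rightarrow> int) set"
    assume f: "embedding_into (comb_graph d) (lattice_graph d M) U f"
    assume U: "U \<subseteq> verts (lattice_graph d M)"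
    let ?o = "\<lambda>i\<in>{1..d}. 0 :: int"
    have "?o \<in> lattice d" by (simp add: lattice_def)
    moreover have fl: "f x \<in> lattice d" if "x \<in> lattice d" for x
      using f U that unfolding embedding_into_def vG vH by blast
    moreover have "f x \<in> A (f ?o) x" if "x \<in> lattice d" for x
      unfolding A_def using fl[OF that] r[OF that f] by blast
    ultimately show "\<exists>v\<in>verts (lattice_graph d M). \<forall>x\<in>verts (comb_graph d). f x \<in> A v x"
      unfolding vG vH by blast
  qed (simp_all add: vG vH countable_lattice)
qed

section \<open>The critical probability of the comb\<close>

lemma drained_closed_blocks:
  assumes d: "2 \<le> d" and no: "\<And>i R. Suc i \<le> R \<Longrightarrow> \<not> dense_walk d L ((column d i)(1 := 6 * (1 + int i))) R \<omega>"
  shows "drained d (closed_blocks d L \<omega>)"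
proof -
  interpret bad_sites d "closed_blocks d L \<omega>" by unfold_locales (rule d)
  show ?thesis
  proof
    fix c assume "c \<in> lattice d"
    then obtain i where i: "c = column d i" using range_column by blast
    have "\<not> wet (c(1 := 6 * (1 + int i)))"
    proof
      assume "wet (c(1 := 6 * (1 + int i)))"
      then obtain k where "c(1 := 6 * (1 + int i)) \<in> flood k" unfolding wet_def by blast
      from flood_dense_walk[OF this, of i] show False
        using no[of i] unfolding i dense_walk_def by auto
    qed
    then show "\<exists>a. \<not> wet (c(1 := a))" by blast
  qed
qed

text \<open>
  Each point of the comb is mapped to an open site of the block where it is placed. Blocks at distance
  two have their sites within distance \<open>3 * L\<close>.
\<close>
lemma comb_embedding:
  assumes d: "2 \<le> d" and dr: "drained d (closed_blocks d L \<omega>)" and LM: "3 * L \<le> M"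
  shows "\<exists>f. embedding_into (comb_graph d) (lattice_graph d M) (open_set (lattice_graph d M) \<omega>) f"
proof -
  interpret drained d "closed_blocks d L \<omega>" by (rule dr)
  have "\<exists>j<L. \<omega> (site L (place z) j)" if "z \<in> lattice d" for z
    using place_lattice[OF that] place_not_bad[OF that] unfolding closed_blocks_def by blast
  then obtain j where j: "\<And>z. z \<in> lattice d \<Longrightarrow> j z < L"
    "\<And>z. z \<in> lattice d \<Longrightarrow> \<omega> (site L (place z) (j z))" by metis
  define f where "f z = site L (place z) (j z)" for z
  have f_lattice: "f z \<in> lattice d" if "z \<in> lattice d" for z
    unfolding f_def using site_lattice place_lattice[OF that] d by simp
  have f_inj: "inj_on f (lattice d)"
  proof (rule inj_onI)
    fix z w assume zw: "z \<in> lattice d" "w \<in> lattice d" and "f z = f w"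
    then have "place z = place w" using site_inj j(1) unfolding f_def by blast
    then show "z = w" using place_inj zw by (simp add: inj_on_eq_iff)
  qed
  have f_edge: "{f z, f w} \<in> edges (lattice_graph d M)"
    if zw: "z \<in> lattice d" "w \<in> lattice d" "z \<noteq> w" "near d 2 (place z) (place w)" for z w
  proof (rule lattice_edgeI)
    show "f z \<noteq> f w" using zw f_inj by (simp add: inj_on_eq_iff)
    have "near d (int (3 * L)) (f z) (f w)"
      unfolding f_def by (intro site_near zw j)
    then show "near d (int M) (f z) (f w)" by (rule near_mono) (use LM in simp)
  qed (use d zw f_lattice in auto)
  have "{f x, f y} \<in> edges (lattice_graph d M)" if "{x, y} \<in> edges (comb_graph d)" for x y
  proof -
    have img: "{f x, f y} = {f z, f w}" if "{x, y} = {z, w}" for z w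
      using that by (auto simp: doubleton_eq_iff)
    from that show ?thesis
    proof (cases rule: comb_edge_cases)
      case (1 z i)
      have "near d 2 (place z) (place (z(i := z i + 1)))"
        using place_tooth[OF 1(1-3)] near_mono by fastforce
      moreover have "z(i := z i + 1) \<in> lattice d" using 1 by (intro lattice_upd) auto
      moreover have "z \<noteq> z(i := z i + 1)" by (auto simp: fun_eq_iff)
      ultimately show ?thesis using f_edge[OF 1(1)] img[OF 1(4)] by simp
    next
      case (2 z)
      have "z \<noteq> z(d := z d + 1)" by (auto simp: fun_eq_iff)
      then show ?thesis
        using f_edge[OF 2(1) upd_d[OF 2(1)]] place_spine[OF 2(1,2)] img[OF 2(3)] by simp
    qed
  qed
  moreover have "f ` lattice d \<subseteq> open_set (lattice_graph d M) \<omega>"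
    using f_lattice j(2) unfolding open_set_def f_def by (auto simp: lattice_graph_def)
  ultimately have "embedding_into (comb_graph d) (lattice_graph d M) (open_set (lattice_graph d M) \<omega>) f"
    using f_inj unfolding embedding_into_def by (simp add: comb_graph_def)
  then show ?thesis by blast
qed

lemma critical_prob_le:
  assumes d: "2 \<le> d" and p: "0 < p" "p < 1"
  shows "\<exists>m. \<forall>M\<ge>m. critical_prob (comb_graph d) (lattice_graph d M) \<in> {0..p}"
proof -
  define \<epsilon> :: real where "\<epsilon> = (1 / (4 * ((3 ^ d) ^ 6 * 2 ^ 7))) ^ 4"
  have "0 < \<epsilon>" unfolding \<epsilon>_def by (intro zero_less_power divide_pos_pos mult_pos_pos) auto
  then obtain L where L: "(1 - p) ^ L < \<epsilon>" using real_arch_pow_inv[of \<epsilon> "1 - p"] p by auto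
  have "critical_prob (comb_graph d) (lattice_graph d M) \<in> {0..p}" if M: "3 * L \<le> M" for M
  proof -
    let ?\<mu> = "site_percolation (lattice_graph d M)"
    let ?E = "\<lambda>q. {\<omega> \<in> space (?\<mu> q).
      \<exists>f. embedding_into (comb_graph d) (lattice_graph d M) (open_set (lattice_graph d M) \<omega>) f}"
    let ?D = "{\<omega> \<in> space (?\<mu> p). \<forall>i. \<forall>R\<ge>Suc i. \<not> dense_walk d L ((column d i)(1 := 6 * (1 + int i))) R \<omega>}"
    let ?P = "{q \<in> {0..1}. measure (?\<mu> q) (?E q) > 0}"
    interpret prob_space "?\<mu> p" by (rule prob_space_site_percolation)
    have "0 < prob ?D"
      using no_dense_walk_positive[OF d, of p L M] p L unfolding \<epsilon>_def by simp
    also have "prob ?D \<le> prob (?E p)"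
    proof (rule finite_measure_mono)
      show "?D \<subseteq> ?E p" using drained_closed_blocks[OF d] comb_embedding[OF d _ M] by blast
      show "?E p \<in> events" by (rule comb_embedding_event[OF d])
    qed
    finally have "p \<in> ?P" using p by simp
    then have "Inf ?P \<le> p" by (rule cInf_lower) (auto intro!: bdd_belowI[of _ 0])
    moreover have "0 \<le> Inf ?P" using \<open>p \<in> ?P\<close> by (intro cInf_greatest) auto
    ultimately show ?thesis unfolding critical_prob_def by simp
  qed
  then show ?thesis by blast
qed

theorem corollary2:
  fixes d :: nat
  assumes "d \<ge> 2"
  shows "(\<lambda>M. critical_prob (comb_graph d) (lattice_graph d M)) \<longlonglongrightarrow> 0"
proof (rule LIMSEQ_I)
  fix r :: real assume r: "0 < r"
  define p where "p = min (1 / 2) (r / 2)"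
  have p: "0 < p" "p < 1" "p < r" using r by (auto simp: p_def)
  obtain m where "\<forall>M\<ge>m. critical_prob (comb_graph d) (lattice_graph d M) \<in> {0..p}"
    using critical_prob_le[OF assms p(1,2)] by blast
  then show "\<exists>no. \<forall>M\<ge>no. norm (critical_prob (comb_graph d) (lattice_graph d M) - 0) < r"
    using p(3) by (intro exI[of _ m]) fastforce
qed

end
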